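(* Consider a specialized driver of the form $g_\theta(t,x,z)=\frac{\alpha}{2}z^2-\beta$, where $\theta=(\alpha,\beta)$ are real constants with $\alpha\ne0$ and $\beta/\alpha>0$, and put $\nu_\theta:=\sqrt{2\beta/\alpha}$. Let $(M_t)_{t\ge0}$ be the corresponding canonical Neural-Brownian Motion. Define a new measure $\mathbb{Q}_\alpha$, equivalent to $\mathbb{P}$, via the Radon–Nikodym density process generated by the Girsanov kernel $\gamma_t:=\alpha\nu_\theta$, i.e. $$\frac{d\mathbb{Q}_\alpha}{d\mathbb{P}}\Big|_{\mathcal{F}_t}=\exp\Big(\int_0^t\gamma_s\,dW_s-\frac12\int_0^t\gamma_s^2\,ds\Big),\qquad t\in[0,T].$$ Then, under $\mathbb{Q}_\alpha$, $(M_t)$ is a semimartingale with dynamics $$dM_t=\alpha\nu_\theta^2\,dt+\nu_\theta\,dW^\alpha_t,$$ where $W^\alpha$ is a standard Brownian motion under $\mathbb{Q}_\alpha$.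
   Context: $(\Omega,\mathcal{F},\mathbb{P})$ is a complete probability space, $T>0$ is fixed, $W$ is a one-dimensional standard Brownian motion on $[0,T]$, and $(\mathcal{F}_t)$ is its augmented natural filtration. A driver is a function $f_\theta(t,x,y,z)$ on $[0,T]\times\mathbb{R}^3$ with real values; its specialization is $g_\theta(t,m,z):=f_\theta(t,m,m,z)$. Neural expectation: for an adapted exogenous process $X$, times $s\le t\le T$ and an $\mathcal{F}_t$-measurable square-integrable $\xi$, $\mathcal{E}^\theta[\xi\mid\mathcal{F}_s]:=Y_s$, where $(Y,Z)$ is the unique adapted solution on $[s,t]$ of the BSDE $-dY_u=f_\theta(u,X_u,Y_u,Z_u)\,du-Z_u\,dW_u$, $Y_t=\xi$; when applied to a process $M$ itself, $X=M$ and $\xi=M_t$. A Neural-Brownian Motion (NBM) is a one-dimensional Itô process $M$ with $M_0=0$, a.s. continuous paths, and $M_s=\mathcal{E}^\theta[M_t\mid\mathcal{F}_s]$ for all $0\le s\le t\le T$; it is canonical if it has zero drift under $\mathbb{P}$. The corresponding canonical NBM is, per the paper's representation theorem, the unique strong solution of $dM_t=\nu_\theta(t,M_t)\,dW_t$, $M_0=0$, where $\nu_\theta(t,x)$ is the unique positive root $z$ of $g_\theta(t,x,z)=0$ (here the constant $\sqrt{2\beta/\alpha}$). *)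

theory Defs
  imports "HOL-Probability.Probability"
begin

text \<open>
  A real-valued process is a function \<open>X :: real \<Rightarrow> 'a \<Rightarrow> real\<close> (time first); only its values at
  the times of the interval under consideration matter. A filtration is a family
  \<open>F :: real \<Rightarrow> 'a measure\<close> of which only spaces and sigma-algebras are used, so the same \<open>F\<close>
  serves under several probability measures.
\<close>

type_synonym 'a process = "real \<Rightarrow> 'a \<Rightarrow> real"

section \<open>Filtrations, processes and Brownian motion\<close>

definition natural_filtration :: "'a measure \<Rightarrow> 'a process \<Rightarrow> real \<Rightarrow> 'a measure" where
  "natural_filtration P W t =
     sigma (space P) {W s -` B \<inter> space P | s B. s \<in> {0..t} \<and> B \<in> sets borel}"

definition augmented_filtration :: "'a measure \<Rightarrow> 'a process \<Rightarrow> real \<Rightarrow> 'a measure" where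
  "augmented_filtration P W t =
     sigma (space P) (sets (natural_filtration P W t) \<union> null_sets P)"

definition adapted :: "(real \<Rightarrow> 'a measure) \<Rightarrow> real \<Rightarrow> real \<Rightarrow> 'a process \<Rightarrow> bool" where
  "adapted F a b X \<longleftrightarrow> (\<forall>t\<in>{a..b}. X t \<in> borel_measurable (F t))"

definition progressive :: "(real \<Rightarrow> 'a measure) \<Rightarrow> real \<Rightarrow> real \<Rightarrow> 'a process \<Rightarrow> bool" where
  "progressive F a b X \<longleftrightarrow>
     (\<forall>t\<in>{a..b}. (\<lambda>(u, \<omega>). X u \<omega>) \<in> borel_measurable (restrict_space borel {a..t} \<Otimes>\<^sub>M F t))"

definition continuous_paths :: "'a measure \<Rightarrow> real \<Rightarrow> real \<Rightarrow> 'a process \<Rightarrow> bool" where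
  "continuous_paths P a b X \<longleftrightarrow> (AE \<omega> in P. continuous_on {a..b} (\<lambda>t. X t \<omega>))"

text \<open>Standard Brownian motion on \<open>[0,T]\<close> relative to \<open>F\<close>; the ordinary notion is obtained by
  taking the natural filtration of the process itself.\<close>

definition brownian_motion ::
    "'a measure \<Rightarrow> (real \<Rightarrow> 'a measure) \<Rightarrow> real \<Rightarrow> 'a process \<Rightarrow> bool" where
  "brownian_motion P F T W \<longleftrightarrow>
     prob_space P \<and>
     (\<forall>t\<in>{0..T}. subalgebra P (F t)) \<and>
     adapted F 0 T W \<and>
     continuous_paths P 0 T W \<and>
     (AE \<omega> in P. W 0 \<omega> = 0) \<and>
     (\<forall>s t. 0 \<le> s \<longrightarrow> s < t \<longrightarrow> t \<le> T \<longrightarrow>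
        distributed P lborel (\<lambda>\<omega>. W t \<omega> - W s \<omega>) (normal_density 0 (sqrt (t - s))) \<and>
        prob_space.indep_set P (sets (F s))
          {(\<lambda>\<omega>. W t \<omega> - W s \<omega>) -` B \<inter> space P | B. B \<in> sets borel})"

definition tendsto_in_prob :: "'a measure \<Rightarrow> (nat \<Rightarrow> 'a \<Rightarrow> real) \<Rightarrow> ('a \<Rightarrow> real) \<Rightarrow> bool" where
  "tendsto_in_prob P X Y \<longleftrightarrow>
     (\<forall>\<epsilon>>0. (\<lambda>k. measure P {\<omega> \<in> space P. \<epsilon> < \<bar>X k \<omega> - Y \<omega>\<bar>}) \<longlonglongrightarrow> 0)"


section \<open>The Ito integral\<close>

text \<open>Simple integrands on \<open>[a,b]\<close>: partition points \<open>\<tau> 0 \<le> \<dots> \<le> \<tau> n\<close> and bounded coefficients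
  \<open>h i\<close> known at time \<open>\<tau> i\<close>.\<close>

definition simple_integrand ::
    "'a measure \<Rightarrow> (real \<Rightarrow> 'a measure) \<Rightarrow> real \<Rightarrow> real \<Rightarrow> nat \<Rightarrow> (nat \<Rightarrow> real) \<Rightarrow>
     (nat \<Rightarrow> 'a \<Rightarrow> real) \<Rightarrow> bool" where
  "simple_integrand P F a b n \<tau> h \<longleftrightarrow>
     \<tau> 0 = a \<and> \<tau> n = b \<and> (\<forall>i<n. \<tau> i \<le> \<tau> (Suc i)) \<and>
     (\<forall>i<n. h i \<in> borel_measurable (F (\<tau> i)) \<and> (\<exists>B. \<forall>\<omega>\<in>space P. \<bar>h i \<omega>\<bar> \<le> B))"

definition simple_process ::
    "nat \<Rightarrow> (nat \<Rightarrow> real) \<Rightarrow> (nat \<Rightarrow> 'a \<Rightarrow> real) \<Rightarrow> 'a process" where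
  "simple_process n \<tau> h u \<omega> = (\<Sum>i<n. h i \<omega> * indicator {\<tau> i<..\<tau> (Suc i)} u)"

definition simple_integral ::
    "'a process \<Rightarrow> nat \<Rightarrow> (nat \<Rightarrow> real) \<Rightarrow> (nat \<Rightarrow> 'a \<Rightarrow> real) \<Rightarrow> 'a process" where
  "simple_integral W n \<tau> h u \<omega> =
     (\<Sum>i<n. h i \<omega> * (W (min u (\<tau> (Suc i))) \<omega> - W (min u (\<tau> i)) \<omega>))"

text \<open>\<open>ito_integral P F W a b H I\<close>: the process \<open>I\<close> is (a continuous version of) the Ito integral
  of \<open>H\<close> from \<open>a\<close> to \<open>u\<close>, \<open>u \<in> [a,b]\<close>. As usual, \<open>H\<close> is progressive with almost surely
  square-integrable paths and the integral is the limit in probability of integrals of simple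
  processes that approximate \<open>H\<close> in \<open>L\<^sup>2([a,b])\<close> in probability. By continuity of the paths, the
  limits at the single times determine \<open>I\<close> up to indistinguishability.\<close>

definition ito_integral ::
    "'a measure \<Rightarrow> (real \<Rightarrow> 'a measure) \<Rightarrow> 'a process \<Rightarrow> real \<Rightarrow> real \<Rightarrow>
     'a process \<Rightarrow> 'a process \<Rightarrow> bool" where
  "ito_integral P F W a b H I \<longleftrightarrow>
     progressive F a b H \<and>
     (AE \<omega> in P. set_integrable lborel {a..b} (\<lambda>u. (H u \<omega>)\<^sup>2)) \<and>
     adapted F a b I \<and> continuous_paths P a b I \<and>
     (\<exists>n \<tau> h.
        (\<forall>k. simple_integrand P F a b (n k) (\<tau> k) (h k)) \<and>
        tendsto_in_prob P
          (\<lambda>k \<omega>. LBINT u:{a..b}. (simple_process (n k) (\<tau> k) (h k) u \<omega> - H u \<omega>)\<^sup>2) (\<lambda>\<omega>. 0) \<and>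
        (\<forall>u\<in>{a..b}. tendsto_in_prob P (\<lambda>k. simple_integral W (n k) (\<tau> k) (h k) u) (I u)))"

text \<open>\<open>dX\<^sub>u = \<beta>\<^sub>u du + \<sigma>\<^sub>u dW\<^sub>u\<close> on \<open>[a,b]\<close>. The drift is only required to be pathwise integrable:
  that its integral is adapted follows from the adaptedness of \<open>X\<close> and of the Ito integral.\<close>

definition has_ito_differential ::
    "'a measure \<Rightarrow> (real \<Rightarrow> 'a measure) \<Rightarrow> 'a process \<Rightarrow> real \<Rightarrow> real \<Rightarrow>
     'a process \<Rightarrow> 'a process \<Rightarrow> 'a process \<Rightarrow> bool" where
  "has_ito_differential P F W a b X \<beta> \<sigma> \<longleftrightarrow>
     adapted F a b X \<and> continuous_paths P a b X \<and>
     (AE \<omega> in P. set_integrable lborel {a..b} (\<lambda>u. \<beta> u \<omega>)) \<and>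
     (\<exists>I. ito_integral P F W a b \<sigma> I \<and>
        (AE \<omega> in P. \<forall>u\<in>{a..b}. X u \<omega> = X a \<omega> + (LBINT r:{a..u}. \<beta> r \<omega>) + I u \<omega>))"

definition ito_process ::
    "'a measure \<Rightarrow> (real \<Rightarrow> 'a measure) \<Rightarrow> 'a process \<Rightarrow> real \<Rightarrow> 'a process \<Rightarrow> bool" where
  "ito_process P F W T X \<longleftrightarrow>
     (\<exists>\<beta> \<sigma>. progressive F 0 T \<beta> \<and> has_ito_differential P F W 0 T X \<beta> \<sigma>)"

text \<open>Strong solution: adapted to the augmented filtration of the driving Brownian motion.\<close>

definition sde_strong_solution ::
    "'a measure \<Rightarrow> 'a process \<Rightarrow> real \<Rightarrow> (real \<Rightarrow> real \<Rightarrow> real) \<Rightarrow> (real \<Rightarrow> real \<Rightarrow> real) \<Rightarrow>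
     real \<Rightarrow> 'a process \<Rightarrow> bool" where
  "sde_strong_solution P W T b \<sigma> x\<^sub>0 X \<longleftrightarrow>
     (AE \<omega> in P. X 0 \<omega> = x\<^sub>0) \<and>
     has_ito_differential P (augmented_filtration P W) W 0 T X
       (\<lambda>u \<omega>. b u (X u \<omega>)) (\<lambda>u \<omega>. \<sigma> u (X u \<omega>))"


section \<open>Neural expectation and Neural-Brownian Motion\<close>

text \<open>A driver is \<open>f t x y z\<close>.\<close>

type_synonym driver = "real \<Rightarrow> real \<Rightarrow> real \<Rightarrow> real \<Rightarrow> real"

definition specialization :: "driver \<Rightarrow> real \<Rightarrow> real \<Rightarrow> real \<Rightarrow> real" where
  "specialization f t m z = f t m m z"

definition bsde_solution ::
    "'a measure \<Rightarrow> (real \<Rightarrow> 'a measure) \<Rightarrow> 'a process \<Rightarrow> driver \<Rightarrow> 'a process \<Rightarrow>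
     real \<Rightarrow> real \<Rightarrow> ('a \<Rightarrow> real) \<Rightarrow> 'a process \<Rightarrow> 'a process \<Rightarrow> bool" where
  "bsde_solution P F W f X s t \<xi> Y Z \<longleftrightarrow>
     has_ito_differential P F W s t Y (\<lambda>u \<omega>. - f u (X u \<omega>) (Y u \<omega>) (Z u \<omega>)) Z \<and>
     (AE \<omega> in P. Y t \<omega> = \<xi> \<omega>)"

text \<open>\<open>neural_expectation P F W S f X s t \<xi> \<eta>\<close>: the neural expectation of \<open>\<xi>\<close> given \<open>F s\<close> is
  defined and equals \<open>\<eta>\<close> almost surely. \<open>S s t\<close> is the class of pairs \<open>(Y, Z)\<close> in which BSDEs on
  \<open>[s,t]\<close> are solved. Uniqueness of BSDE solutions always refers to such a class, and which one is
  appropriate depends on the driver: for a driver that is quadratic in \<open>z\<close>, uniqueness fails for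
  square-integrable pairs and holds, for instance, when the running maximum of \<open>\<bar>Y\<bar>\<close> has
  exponential moments of all orders.\<close>

definition neural_expectation ::
    "'a measure \<Rightarrow> (real \<Rightarrow> 'a measure) \<Rightarrow> 'a process \<Rightarrow>
     (real \<Rightarrow> real \<Rightarrow> ('a process \<times> 'a process) set) \<Rightarrow> driver \<Rightarrow> 'a process \<Rightarrow>
     real \<Rightarrow> real \<Rightarrow> ('a \<Rightarrow> real) \<Rightarrow> ('a \<Rightarrow> real) \<Rightarrow> bool" where
  "neural_expectation P F W S f X s t \<xi> \<eta> \<longleftrightarrow>
     adapted F s t X \<and>
     \<xi> \<in> borel_measurable (F t) \<and> integrable P (\<lambda>\<omega>. (\<xi> \<omega>)\<^sup>2) \<and>
     (\<exists>Y Z. (Y, Z) \<in> S s t \<and> bsde_solution P F W f X s t \<xi> Y Z \<and>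
        (\<forall>Y' Z'. (Y', Z') \<in> S s t \<and> bsde_solution P F W f X s t \<xi> Y' Z' \<longrightarrow>
           (AE \<omega> in P. \<forall>u\<in>{s..t}. Y' u \<omega> = Y u \<omega>) \<and>
           (AE \<omega> in P. AE u in lborel. u \<in> {s..t} \<longrightarrow> Z' u \<omega> = Z u \<omega>)) \<and>
        (AE \<omega> in P. \<eta> \<omega> = Y s \<omega>))"

definition neural_brownian_motion ::
    "'a measure \<Rightarrow> (real \<Rightarrow> 'a measure) \<Rightarrow> 'a process \<Rightarrow> real \<Rightarrow>
     (real \<Rightarrow> real \<Rightarrow> ('a process \<times> 'a process) set) \<Rightarrow> driver \<Rightarrow> 'a process \<Rightarrow> bool" where
  "neural_brownian_motion P F W T S f M \<longleftrightarrow>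
     ito_process P F W T M \<and>
     (AE \<omega> in P. M 0 \<omega> = 0) \<and>
     continuous_paths P 0 T M \<and>
     (\<forall>s t. 0 \<le> s \<longrightarrow> s \<le> t \<longrightarrow> t \<le> T \<longrightarrow> neural_expectation P F W S f M s t (M t) (M s))"

definition canonical_NBM ::
    "'a measure \<Rightarrow> (real \<Rightarrow> 'a measure) \<Rightarrow> 'a process \<Rightarrow> real \<Rightarrow>
     (real \<Rightarrow> real \<Rightarrow> ('a process \<times> 'a process) set) \<Rightarrow> driver \<Rightarrow> 'a process \<Rightarrow> bool" where
  "canonical_NBM P F W T S f M \<longleftrightarrow>
     neural_brownian_motion P F W T S f M \<and>
     (\<exists>\<sigma>. has_ito_differential P F W 0 T M (\<lambda>_ _. 0) \<sigma>)"

definition positive_root :: "(real \<Rightarrow> real \<Rightarrow> real \<Rightarrow> real) \<Rightarrow> real \<Rightarrow> real \<Rightarrow> real" where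
  "positive_root g t x = (THE z. 0 < z \<and> g t x z = 0)"

text \<open>The canonical NBM corresponding to \<open>f\<close>. The condition on the positive root is not redundant:
  being a canonical NBM does not fix the sign of the diffusion coefficient.\<close>

definition corresponding_canonical_NBM ::
    "'a measure \<Rightarrow> 'a process \<Rightarrow> real \<Rightarrow>
     (real \<Rightarrow> real \<Rightarrow> ('a process \<times> 'a process) set) \<Rightarrow> driver \<Rightarrow> 'a process \<Rightarrow> bool" where
  "corresponding_canonical_NBM P W T S f M \<longleftrightarrow>
     canonical_NBM P (augmented_filtration P W) W T S f M \<and>
     sde_strong_solution P W T (\<lambda>_ _. 0) (positive_root (specialization f)) 0 M"


section \<open>Change of measure and semimartingales\<close>

definition equivalent_measure :: "'a measure \<Rightarrow> 'a measure \<Rightarrow> bool" where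
  "equivalent_measure P Q \<longleftrightarrow>
     sets Q = sets P \<and> absolutely_continuous P Q \<and> absolutely_continuous Q P"

text \<open>\<open>Q\<close> is equivalent to \<open>P\<close> and has, on every \<open>F t\<close>, the density generated by the Girsanov
  kernel \<open>\<gamma>\<close>. \<open>J\<close> is the Ito integral of \<open>\<gamma>\<close>.\<close>

definition girsanov_measure ::
    "'a measure \<Rightarrow> (real \<Rightarrow> 'a measure) \<Rightarrow> 'a process \<Rightarrow> real \<Rightarrow> 'a process \<Rightarrow>
     'a measure \<Rightarrow> bool" where
  "girsanov_measure P F W T \<gamma> Q \<longleftrightarrow>
     equivalent_measure P Q \<and>
     (\<exists>J. ito_integral P F W 0 T \<gamma> J \<and>
        (\<forall>t\<in>{0..T}. restr_to_subalg Q (F t) =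
           density (restr_to_subalg P (F t))
             (\<lambda>\<omega>. ennreal (exp (J t \<omega> - 1 / 2 * (LBINT s:{0..t}. (\<gamma> s \<omega>)\<^sup>2))))))"

definition martingale ::
    "'a measure \<Rightarrow> (real \<Rightarrow> 'a measure) \<Rightarrow> real \<Rightarrow> 'a process \<Rightarrow> bool" where
  "martingale Q F T X \<longleftrightarrow>
     adapted F 0 T X \<and> (\<forall>t\<in>{0..T}. integrable Q (X t)) \<and>
     (\<forall>s t. 0 \<le> s \<longrightarrow> s \<le> t \<longrightarrow> t \<le> T \<longrightarrow> (AE \<omega> in Q. real_cond_exp Q (F s) (X t) \<omega> = X s \<omega>))"

definition cadlag_on :: "real \<Rightarrow> (real \<Rightarrow> real) \<Rightarrow> bool" where
  "cadlag_on T x \<longleftrightarrow>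
     (\<forall>t\<in>{0..<T}. (x \<longlongrightarrow> x t) (at_right t)) \<and> (\<forall>t\<in>{0<..T}. \<exists>l. (x \<longlongrightarrow> l) (at_left t))"

definition finite_variation_on :: "real \<Rightarrow> (real \<Rightarrow> real) \<Rightarrow> bool" where
  "finite_variation_on T x \<longleftrightarrow>
     (\<exists>B. \<forall>n \<tau>. (\<forall>i\<le>n. \<tau> i \<in> {0..T}) \<and> (\<forall>i<n. \<tau> i \<le> \<tau> (Suc i)) \<longrightarrow>
        (\<Sum>i<n. \<bar>x (\<tau> (Suc i)) - x (\<tau> i)\<bar>) \<le> B)"

definition local_martingale ::
    "'a measure \<Rightarrow> (real \<Rightarrow> 'a measure) \<Rightarrow> real \<Rightarrow> 'a process \<Rightarrow> bool" where
  "local_martingale Q F T X \<longleftrightarrow>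
     adapted F 0 T X \<and> (AE \<omega> in Q. cadlag_on T (\<lambda>t. X t \<omega>)) \<and>
     (\<exists>\<tau> :: nat \<Rightarrow> 'a \<Rightarrow> real.
        (\<forall>n. \<forall>\<omega>\<in>space Q. \<tau> n \<omega> \<in> {0..T}) \<and>
        (\<forall>n. \<forall>t\<in>{0..T}. Measurable.pred (F t) (\<lambda>\<omega>. \<tau> n \<omega> \<le> t)) \<and>
        (\<forall>n. AE \<omega> in Q. \<tau> n \<omega> \<le> \<tau> (Suc n) \<omega>) \<and>
        (AE \<omega> in Q. \<exists>n. \<tau> n \<omega> = T) \<and>
        (\<forall>n. martingale Q F T (\<lambda>t \<omega>. X (min t (\<tau> n \<omega>)) \<omega> - X 0 \<omega>)))"

definition semimartingale ::
    "'a measure \<Rightarrow> (real \<Rightarrow> 'a measure) \<Rightarrow> real \<Rightarrow> 'a process \<Rightarrow> bool" where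
  "semimartingale Q F T X \<longleftrightarrow>
     adapted F 0 T X \<and> (AE \<omega> in Q. cadlag_on T (\<lambda>t. X t \<omega>)) \<and>
     (\<exists>N A. local_martingale Q F T N \<and>
        adapted F 0 T A \<and>
        (AE \<omega> in Q. cadlag_on T (\<lambda>t. A t \<omega>) \<and> finite_variation_on T (\<lambda>t. A t \<omega>)) \<and>
        (AE \<omega> in Q. \<forall>t\<in>{0..T}. X t \<omega> = X 0 \<omega> + N t \<omega> + A t \<omega>))"

end

theory Submission
  imports Defs
begin

text \<open>
  The diffusion coefficient of the canonical Neural-Brownian Motion is the positive root of the
  quadratic \<open>\<alpha> / 2 * z\<^sup>2 - \<beta>\<close>, that is, the constant \<open>\<nu>\<close>
  (\<open>positive_root_quadratic\<close>), so \<open>M\<close> is an Ito integral of a constant. The integral of a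
  constant \<open>c\<close> against \<open>W\<close> is \<open>c * W\<close>, hence \<open>M = \<nu> W\<close> and the density process of
  \<open>Q\<close> is the geometric Brownian motion \<open>exp (c W\<^sub>t - c\<^sup>2 t / 2)\<close> with \<open>c = \<alpha> \<nu>\<close>.

  A centred Gaussian density multiplied by \<open>exp (c x - c\<^sup>2 d / 2)\<close>, where \<open>d\<close> is its variance, is
  the same Gaussian shifted by \<open>c d\<close> (\<open>gaussian_tilt\<close>). Applied to one increment of \<open>W\<close>,
  which is independent of the past, this says at once that the density process is a martingale
  and that under \<open>Q\<close> the increments of \<open>W\<^sub>t - c t\<close> are again Gaussian with unchanged
  variance and independent of the past (\<open>brownian_motion_girsanov\<close>). With
  \<open>B\<^sub>t = W\<^sub>t - \<alpha> \<nu> t\<close> the dynamics are then pure algebra: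
  \<open>\<nu> W\<^sub>t = \<alpha> \<nu>\<^sup>2 t + \<nu> B\<^sub>t\<close>.

  What takes work is that the stochastic integral of a constant is what it should be
  (\<open>ito_integral_const_unique\<close>). An Ito integral is a limit in probability along \<^emph>\<open>some\<close>
  sequence of simple integrands that converges to the constant in \<open>L\<^sup>2\<close> in probability. That the
  limit does not depend on the sequence is a continuity statement for the integral of simple
  processes, the tail estimate \<open>simple_integral_tail\<close>: truncate the integrand once its
  accumulated energy exceeds a level, apply the Ito isometry to the truncated integrand, and
  use Markov's inequality.
\<close>

section \<open>Brownian increments\<close>

lemma brownian_motionD:
  assumes "brownian_motion P F T W"
  shows "prob_space P" "\<And>t. t \<in> {0..T} \<Longrightarrow> subalgebra P (F t)" "adapted F 0 T W"
    "continuous_paths P 0 T W" "AE \<omega> in P. W 0 \<omega> = 0"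
    "\<And>s t. 0 \<le> s \<Longrightarrow> s < t \<Longrightarrow> t \<le> T \<Longrightarrow>
      distributed P lborel (\<lambda>\<omega>. W t \<omega> - W s \<omega>) (normal_density 0 (sqrt (t - s)))"
    "\<And>s t. 0 \<le> s \<Longrightarrow> s < t \<Longrightarrow> t \<le> T \<Longrightarrow> prob_space.indep_set P (sets (F s))
      {(\<lambda>\<omega>. W t \<omega> - W s \<omega>) -` B \<inter> space P | B. B \<in> sets borel}"
  using assms unfolding brownian_motion_def by auto

lemma adaptedD:
  assumes "adapted F 0 T X" "\<And>t. t \<in> {0..T} \<Longrightarrow> subalgebra P (F t)" "t \<in> {0..T}"
  shows "X t \<in> borel_measurable (F t)" "X t \<in> borel_measurable P"
proof -
  show "X t \<in> borel_measurable (F t)" using assms unfolding adapted_def by blast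
  then show "X t \<in> borel_measurable P" by (rule measurable_from_subalg[OF assms(2)[OF assms(3)]])
qed

lemma measurable_mono_filtration:
  assumes "subalgebra P A" "subalgebra P B" "sets A \<subseteq> sets B" "X \<in> borel_measurable A"
  shows "X \<in> borel_measurable B"
  using assms by (intro measurable_from_subalg[of B A]) (auto simp: subalgebra_def)

lemma increment_indep_var:
  assumes bm: "brownian_motion P F T W" and st: "0 \<le> s" "s < t" "t \<le> T"
    and X: "X \<in> measurable (F s) N" and g [measurable]: "g \<in> measurable borel N'"
  shows "prob_space.indep_var P N X N' (\<lambda>\<omega>. g (W t \<omega> - W s \<omega>))"
proof -
  note b = brownian_motionD[OF bm]
  interpret prob_space P by (rule b)
  have sub: "subalgebra P (F s)" "subalgebra P (F t)" using b(2) st by auto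
  have [measurable]: "W t \<in> borel_measurable P" "W s \<in> borel_measurable P"
    using adaptedD(2)[OF b(3) b(2)] st by auto
  have XP: "X \<in> measurable P N" using measurable_from_subalg[OF sub(1) X] .
  have sp: "space (F s) = space P" using sub by (auto simp: subalgebra_def)
  have 1: "sigma_sets (space P) {X -` A \<inter> space P |A. A \<in> sets N} \<subseteq> sets (F s)"
    using X sp by (intro sets.sigma_sets_subset[of _ "F s", unfolded sp])
      (auto dest: measurable_sets)
  let ?D = "\<lambda>\<omega>. W t \<omega> - W s \<omega>"
  let ?V = "vimage_algebra (space P) ?D borel"
  have V: "sets ?V = {?D -` A \<inter> space P |A. A \<in> sets borel}"
    by (rule sets_vimage_algebra2) simp
  have gV: "(\<lambda>\<omega>. g (?D \<omega>)) \<in> measurable ?V N'"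
    by (rule measurable_compose[OF measurable_vimage_algebra1 g]) simp
  have 2: "sigma_sets (space P) {(\<lambda>\<omega>. g (?D \<omega>)) -` A \<inter> space P |A. A \<in> sets N'} \<subseteq> sets ?V"
    using gV by (intro sets.sigma_sets_subset[of _ ?V, unfolded space_vimage_algebra])
      (auto dest: measurable_sets)
  have "indep_set (sigma_sets (space P) {X -` A \<inter> space P |A. A \<in> sets N})
      (sigma_sets (space P) {(\<lambda>\<omega>. g (?D \<omega>)) -` A \<inter> space P |A. A \<in> sets N'})"
    unfolding indep_sets2_eq
  proof (intro conjI ballI)
    note i = b(7)[OF st, folded V]
    show "sigma_sets (space P) {X -` A \<inter> space P |A. A \<in> sets N} \<subseteq> events"
      using 1 indep_setD_ev1[OF i] by (rule subset_trans)
    show "sigma_sets (space P) {(\<lambda>\<omega>. g (?D \<omega>)) -` A \<inter> space P |A. A \<in> sets N'} \<subseteq> events"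
      using 2 indep_setD_ev2[OF i] by (rule subset_trans)
    show "prob (a \<inter> c) = prob a * prob c"
      if "a \<in> sigma_sets (space P) {X -` A \<inter> space P |A. A \<in> sets N}"
        "c \<in> sigma_sets (space P) {(\<lambda>\<omega>. g (?D \<omega>)) -` A \<inter> space P |A. A \<in> sets N'}" for a c
      using indep_setD[OF i] that 1 2 by auto
  qed
  then show ?thesis unfolding indep_var_eq using XP by simp
qed

lemma increment_indep_integral:
  fixes X :: "'a \<Rightarrow> real" and g :: "real \<Rightarrow> real"
  assumes bm: "brownian_motion P F T W" and st: "0 \<le> s" "s < t" "t \<le> T"
    and X: "X \<in> borel_measurable (F s)" "integrable P X"
    and g: "g \<in> borel_measurable borel" "integrable P (\<lambda>\<omega>. g (W t \<omega> - W s \<omega>))"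
  shows "integrable P (\<lambda>\<omega>. X \<omega> * g (W t \<omega> - W s \<omega>))"
    "(\<integral>\<omega>. X \<omega> * g (W t \<omega> - W s \<omega>) \<partial>P) = (\<integral>\<omega>. X \<omega> \<partial>P) * (\<integral>\<omega>. g (W t \<omega> - W s \<omega>) \<partial>P)"
proof -
  interpret prob_space P by (rule brownian_motionD[OF bm])
  have i: "indep_var borel X borel (\<lambda>\<omega>. g (W t \<omega> - W s \<omega>))"
    by (rule increment_indep_var[OF bm st X(1) g(1)])
  show "integrable P (\<lambda>\<omega>. X \<omega> * g (W t \<omega> - W s \<omega>))"
    by (rule indep_var_integrable[OF i X(2) g(2)])
  show "(\<integral>\<omega>. X \<omega> * g (W t \<omega> - W s \<omega>) \<partial>P) = (\<integral>\<omega>. X \<omega> \<partial>P) * (\<integral>\<omega>. g (W t \<omega> - W s \<omega>) \<partial>P)"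
    by (rule indep_var_lebesgue_integral[OF i X(2) g(2)])
qed

text \<open>With extended nonnegative integrands no integrability has to be known in advance; the change
  of measure uses this with an exponential of the increment as a factor of \<open>g\<close>.\<close>

lemma increment_nn_integral:
  fixes X :: "'a \<Rightarrow> ennreal" and g :: "real \<Rightarrow> ennreal"
  assumes bm: "brownian_motion P F T W" and st: "0 \<le> s" "s < t" "t \<le> T"
    and X: "X \<in> borel_measurable (F s)" and g [measurable]: "g \<in> borel_measurable borel"
  shows "(\<integral>\<^sup>+\<omega>. X \<omega> * g (W t \<omega> - W s \<omega>) \<partial>P) =
    (\<integral>\<^sup>+\<omega>. X \<omega> \<partial>P) * (\<integral>\<^sup>+x. ennreal (normal_density 0 (sqrt (t - s)) x) * g x \<partial>lborel)"
proof -
  note b = brownian_motionD[OF bm]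
  interpret prob_space P by (rule b)
  let ?D = "\<lambda>\<omega>. W t \<omega> - W s \<omega>"
  let ?G = "\<lambda>\<omega>. g (?D \<omega>)"
  have i: "indep_var borel X borel ?G" by (rule increment_indep_var[OF bm st X g])
  have [measurable]: "X \<in> borel_measurable P" "?G \<in> borel_measurable P"
    using indep_var_rv1[OF i] indep_var_rv2[OF i] by auto
  interpret D: prob_space "distr P borel ?G" by (rule prob_space_distr) simp
  have "(\<integral>\<^sup>+\<omega>. X \<omega> * ?G \<omega> \<partial>P) =
      (\<integral>\<^sup>+p. fst p * snd p \<partial>distr P (borel \<Otimes>\<^sub>M borel) (\<lambda>\<omega>. (X \<omega>, ?G \<omega>)))"
    by (subst nn_integral_distr) auto
  also have "\<dots> = (\<integral>\<^sup>+p. fst p * snd p \<partial>(distr P borel X \<Otimes>\<^sub>M distr P borel ?G))"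
    using i unfolding indep_var_distribution_eq by simp
  also have "\<dots> = (\<integral>\<^sup>+x. \<integral>\<^sup>+y. x * y \<partial>distr P borel ?G \<partial>distr P borel X)"
    by (subst D.nn_integral_fst[symmetric]) auto
  also have "\<dots> = (\<integral>\<^sup>+x. x \<partial>distr P borel X) * (\<integral>\<^sup>+y. y \<partial>distr P borel ?G)"
    by (simp add: nn_integral_cmult nn_integral_multc)
  also have "\<dots> = (\<integral>\<^sup>+\<omega>. X \<omega> \<partial>P) * (\<integral>\<^sup>+\<omega>. ?G \<omega> \<partial>P)"
    by (simp add: nn_integral_distr)
  also have "(\<integral>\<^sup>+\<omega>. g (?D \<omega>) \<partial>P) =
      (\<integral>\<^sup>+x. ennreal (normal_density 0 (sqrt (t - s)) x) * g x \<partial>lborel)"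
    by (rule distributed_nn_integral[OF b(6)[OF st], symmetric]) simp
  finally show ?thesis .
qed

lemma increment_moments:
  assumes bm: "brownian_motion P F T W" and st: "0 \<le> s" "s < t" "t \<le> T"
  shows "integrable P (\<lambda>\<omega>. W t \<omega> - W s \<omega>)" "(\<integral>\<omega>. W t \<omega> - W s \<omega> \<partial>P) = 0"
    "integrable P (\<lambda>\<omega>. (W t \<omega> - W s \<omega>)\<^sup>2)" "(\<integral>\<omega>. (W t \<omega> - W s \<omega>)\<^sup>2 \<partial>P) = t - s"
proof -
  note b = brownian_motionD[OF bm]
  interpret prob_space P by (rule b)
  have pos: "0 < sqrt (t - s)" using st by simp
  note d = b(6)[OF st]
  show "integrable P (\<lambda>\<omega>. W t \<omega> - W s \<omega>)"
    using distributed_integrable_var[OF d] pos integrable_normal_moment_nz_1[OF pos] by simp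
  show e: "(\<integral>\<omega>. W t \<omega> - W s \<omega> \<partial>P) = 0"
    by (rule normal_distributed_expectation[OF pos d])
  show "integrable P (\<lambda>\<omega>. (W t \<omega> - W s \<omega>)\<^sup>2)"
    using distributed_integrable[OF d, of "\<lambda>x. x\<^sup>2"] integrable_normal_moment[OF pos, of 0 2] by simp
  show "(\<integral>\<omega>. (W t \<omega> - W s \<omega>)\<^sup>2 \<partial>P) = t - s"
    using normal_distributed_variance[OF pos d] st unfolding e by simp
qed

section \<open>The augmented filtration\<close>

lemma sets_augmented_filtration:
  "sets (augmented_filtration P W t) =
    sigma_sets (space P) (sets (natural_filtration P W t) \<union> null_sets P)"
  unfolding augmented_filtration_def
  using sets.space_closed[of "natural_filtration P W t"] sets.space_closed[of P]
  by (intro sets_measure_of) (auto simp: natural_filtration_def space_measure_of_conv)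

lemma space_augmented_filtration: "space (augmented_filtration P W t) = space P"
  by (simp add: augmented_filtration_def space_measure_of_conv)

lemma space_natural_filtration: "space (natural_filtration P W t) = space P"
  by (simp add: natural_filtration_def space_measure_of_conv)

lemma natural_subset_augmented:
  "sets (natural_filtration P W t) \<subseteq> sets (augmented_filtration P W t)"
  unfolding sets_augmented_filtration by auto

lemma sets_natural_filtration:
  "sets (natural_filtration P W t) =
    sigma_sets (space P) {W s -` B \<inter> space P | s B. s \<in> {0..t} \<and> B \<in> sets borel}"
  unfolding natural_filtration_def by (intro sets_measure_of) auto

lemma augmented_filtration_mono:
  assumes "s \<le> t"
  shows "sets (augmented_filtration P W s) \<subseteq> sets (augmented_filtration P W t)"
proof -
  have "sets (natural_filtration P W s) \<subseteq> sets (natural_filtration P W t)"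
    unfolding sets_natural_filtration using assms
    by (intro sigma_sets_mono') (auto, force)
  then show ?thesis unfolding sets_augmented_filtration by (intro sigma_sets_mono') auto
qed

lemma subalgebra_augmented:
  assumes "subalgebra P (natural_filtration P W t)"
  shows "subalgebra P (augmented_filtration P W t)"
  unfolding subalgebra_def sets_augmented_filtration space_augmented_filtration
  using assms by (auto intro!: sets.sigma_sets_subset simp: subalgebra_def)

text \<open>Sets that agree almost surely with a set of the natural filtration form a sigma-algebra that
  contains all null sets, so augmenting adds nothing that a probability could detect.\<close>

lemma augmented_ae_natural:
  assumes sub: "subalgebra P (natural_filtration P W t)"
    and "A \<in> sets (augmented_filtration P W t)"
  shows "\<exists>B\<in>sets (natural_filtration P W t). AE \<omega> in P. \<omega> \<in> A \<longleftrightarrow> \<omega> \<in> B"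
  using assms(2) unfolding sets_augmented_filtration
proof (induction rule: sigma_sets.induct)
  case (Basic A)
  then show ?case
  proof
    assume "A \<in> null_sets P"
    then have "AE \<omega> in P. \<omega> \<in> A \<longleftrightarrow> \<omega> \<in> {}" using AE_not_in[of A P] by simp
    then show ?case by blast
  qed auto
next
  case Empty
  show ?case by (rule bexI[of _ "{}"]) auto
next
  case (Compl A)
  then obtain B where B: "B \<in> sets (natural_filtration P W t)" "AE \<omega> in P. \<omega> \<in> A \<longleftrightarrow> \<omega> \<in> B"
    by blast
  have "space P - B \<in> sets (natural_filtration P W t)"
    using sets.compl_sets[OF B(1)] by (simp add: space_natural_filtration)
  moreover have "AE \<omega> in P. \<omega> \<in> space P - A \<longleftrightarrow> \<omega> \<in> space P - B" using B(2) by auto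
  ultimately show ?case by blast
next
  case (Union A)
  then obtain B where B: "\<And>i :: nat. B i \<in> sets (natural_filtration P W t)"
    "\<And>i. AE \<omega> in P. \<omega> \<in> A i \<longleftrightarrow> \<omega> \<in> B i" by metis
  have "AE \<omega> in P. \<forall>i. \<omega> \<in> A i \<longleftrightarrow> \<omega> \<in> B i" using B(2) by (simp add: AE_all_countable)
  then have "AE \<omega> in P. \<omega> \<in> (\<Union>i. A i) \<longleftrightarrow> \<omega> \<in> (\<Union>i. B i)" by eventually_elim auto
  then show ?case using B(1) by (intro bexI[of _ "\<Union>i. B i"]) auto
qed

text \<open>Independence of an increment from the past survives the augmentation because it only concerns
  probabilities, and these do not change when a set is replaced by an almost surely equal one.\<close>

lemma brownian_motion_augmented:
  assumes bm: "brownian_motion P (natural_filtration P W) T W"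
  shows "brownian_motion P (augmented_filtration P W) T W"
proof -
  note b = brownian_motionD[OF bm]
  interpret prob_space P by (rule b)
  let ?N = "natural_filtration P W" and ?F = "augmented_filtration P W"
  have "indep_set (sets (?F s)) {(\<lambda>\<omega>. W t \<omega> - W s \<omega>) -` B \<inter> space P | B. B \<in> sets borel}"
    (is "indep_set _ ?D")
    if st: "0 \<le> s" "s < t" "t \<le> T" for s t
    unfolding indep_sets2_eq
  proof (intro conjI ballI)
    have N: "subalgebra P (?N s)" using b(2) st by auto
    note F = subalgebra_augmented[OF N]
    then show "sets (?F s) \<subseteq> events" by (simp add: subalgebra_def)
    show D: "?D \<subseteq> events" using b(7)[OF st] unfolding indep_sets2_eq by blast
    fix A C assume A: "A \<in> sets (?F s)" and C: "C \<in> ?D"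
    obtain B where B: "B \<in> sets (?N s)" "AE \<omega> in P. \<omega> \<in> A \<longleftrightarrow> \<omega> \<in> B"
      using augmented_ae_natural[OF N A] by blast
    have ev: "A \<in> events" "B \<in> events" "C \<in> events"
      using A B(1) C D N F by (auto simp: subalgebra_def)
    have "prob (A \<inter> C) = prob (B \<inter> C)"
      using B(2) ev by (intro finite_measure_eq_AE) auto
    also have "\<dots> = prob B * prob C"
      by (rule indep_setD[OF b(7)[OF st] B(1) C])
    also have "prob B = prob A" using B(2) ev by (intro finite_measure_eq_AE) auto
    finally show "prob (A \<inter> C) = prob A * prob C" .
  qed
  moreover have "adapted ?F 0 T W"
    unfolding adapted_def
  proof
    fix t assume t: "t \<in> {0..T}"
    note N = b(2)[OF t]
    show "W t \<in> borel_measurable (?F t)"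
      by (rule measurable_mono_filtration[OF N subalgebra_augmented[OF N]
            natural_subset_augmented adaptedD(1)[OF b(3) b(2) t]])
  qed
  ultimately show ?thesis
    using b subalgebra_augmented unfolding brownian_motion_def by blast
qed

section \<open>Integrals of simple processes\<close>

lemma partition_mono:
  fixes \<tau> :: "nat \<Rightarrow> real"
  assumes "\<And>i. i < n \<Longrightarrow> \<tau> i \<le> \<tau> (Suc i)" "i \<le> j" "j \<le> n"
  shows "\<tau> i \<le> \<tau> j"
  using assms(2,3) by (induction rule: dec_induct) (auto intro: order_trans[OF _ assms(1)])

lemma simple_integrandD:
  assumes "simple_integrand P F a b n \<tau> h"
  shows "\<tau> 0 = a" "\<tau> n = b" "\<And>i. i < n \<Longrightarrow> \<tau> i \<le> \<tau> (Suc i)"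
    "\<And>i j. i \<le> j \<Longrightarrow> j \<le> n \<Longrightarrow> \<tau> i \<le> \<tau> j" "\<And>i. i \<le> n \<Longrightarrow> \<tau> i \<in> {a..b}"
    "\<And>i. i < n \<Longrightarrow> h i \<in> borel_measurable (F (\<tau> i))"
    "\<And>i. i < n \<Longrightarrow> \<exists>B. \<forall>\<omega>\<in>space P. \<bar>h i \<omega>\<bar> \<le> B"
proof -
  show \<tau>: "\<tau> 0 = a" "\<tau> n = b" "\<And>i. i < n \<Longrightarrow> \<tau> i \<le> \<tau> (Suc i)"
    and "\<And>i. i < n \<Longrightarrow> h i \<in> borel_measurable (F (\<tau> i))"
      "\<And>i. i < n \<Longrightarrow> \<exists>B. \<forall>\<omega>\<in>space P. \<bar>h i \<omega>\<bar> \<le> B"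
    using assms unfolding simple_integrand_def by auto
  show mono: "\<tau> i \<le> \<tau> j" if "i \<le> j" "j \<le> n" for i j
    using partition_mono[of n \<tau> i j] \<tau>(3) that by blast
  show "\<tau> i \<in> {a..b}" if "i \<le> n" for i
    using mono[of 0 i] mono[of i n] that \<tau>(1,2) by auto
qed

lemma (in prob_space) integrable_bounded_square:
  fixes X :: "'a \<Rightarrow> real"
  assumes [measurable]: "X \<in> borel_measurable M" and B: "\<And>\<omega>. \<omega> \<in> space M \<Longrightarrow> \<bar>X \<omega>\<bar> \<le> B"
  shows "integrable M (\<lambda>\<omega>. (X \<omega>)\<^sup>2)"
proof (rule integrable_const_bound[where B="B\<^sup>2"])
  show "AE \<omega> in M. norm ((X \<omega>)\<^sup>2) \<le> B\<^sup>2"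
    using power_mono[OF B abs_ge_zero, of _ 2] by (intro AE_I2) simp
qed measurable

text \<open>The Ito isometry for simple integrands. Passing from \<open>m\<close> to \<open>m + 1\<close>, the mixed term
  \<open>S m * h m\<close> is known at time \<open>\<sigma> m\<close> and hence independent of the centred next increment, so
  its contribution vanishes. Measurability is part of the induction, and integration up to a time
  \<open>u\<close> is covered by partition points that coincide with \<open>u\<close> from some index on.\<close>

lemma simple_sum_second_moment:
  assumes bm: "brownian_motion P F T W"
    and mono: "\<And>s t. 0 \<le> s \<Longrightarrow> s \<le> t \<Longrightarrow> t \<le> T \<Longrightarrow> sets (F s) \<subseteq> sets (F t)"
    and \<sigma>: "\<And>i. i < n \<Longrightarrow> \<sigma> i \<le> \<sigma> (Suc i)" "\<And>i. i \<le> n \<Longrightarrow> \<sigma> i \<in> {0..T}"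
    and h: "\<And>i. i < n \<Longrightarrow> h i \<in> borel_measurable (F (\<sigma> i))"
      "\<And>i. i < n \<Longrightarrow> \<exists>B. \<forall>\<omega>\<in>space P. \<bar>h i \<omega>\<bar> \<le> B"
    and "m \<le> n"
  defines "S \<equiv> \<lambda>m \<omega>. \<Sum>i<m. h i \<omega> * (W (\<sigma> (Suc i)) \<omega> - W (\<sigma> i) \<omega>)"
  shows "S m \<in> borel_measurable (F (\<sigma> m)) \<and> integrable P (\<lambda>\<omega>. (S m \<omega>)\<^sup>2) \<and>
    (\<integral>\<omega>. (S m \<omega>)\<^sup>2 \<partial>P) = (\<Sum>i<m. (\<integral>\<omega>. (h i \<omega>)\<^sup>2 \<partial>P) * (\<sigma> (Suc i) - \<sigma> i))"
  using \<open>m \<le> n\<close>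
proof (induction m)
  case 0
  then show ?case by (simp add: S_def)
next
  case (Suc m)
  note b = brownian_motionD[OF bm]
  interpret prob_space P by (rule b)
  let ?s = "\<sigma> m" and ?t = "\<sigma> (Suc m)"
  let ?D = "\<lambda>\<omega>. W ?t \<omega> - W ?s \<omega>"
  have le: "0 \<le> ?s" "?s \<le> ?t" "?t \<le> T" and sT: "?s \<in> {0..T}" "?t \<in> {0..T}"
    using \<sigma>(1)[of m] \<sigma>(2)[of m] \<sigma>(2)[of "Suc m"] Suc.prems by auto
  note sub = b(2)[OF sT(1)] b(2)[OF sT(2)]
  note up = measurable_mono_filtration[OF sub mono[OF le]]
  have IH: "S m \<in> borel_measurable (F ?s)" "integrable P (\<lambda>\<omega>. (S m \<omega>)\<^sup>2)"
    "(\<integral>\<omega>. (S m \<omega>)\<^sup>2 \<partial>P) = (\<Sum>i<m. (\<integral>\<omega>. (h i \<omega>)\<^sup>2 \<partial>P) * (\<sigma> (Suc i) - \<sigma> i))"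
    using Suc by auto
  have hm: "h m \<in> borel_measurable (F ?s)" using h(1)[of m] Suc.prems by simp
  obtain B where B: "\<And>\<omega>. \<omega> \<in> space P \<Longrightarrow> \<bar>h m \<omega>\<bar> \<le> B" using h(2)[of m] Suc.prems by auto
  have S_Suc: "S (Suc m) = (\<lambda>\<omega>. S m \<omega> + h m \<omega> * ?D \<omega>)" by (simp add: S_def)
  have [measurable]: "S m \<in> borel_measurable (F ?t)" "h m \<in> borel_measurable (F ?t)"
      "W ?s \<in> borel_measurable (F ?t)" "W ?t \<in> borel_measurable (F ?t)"
    using up IH(1) hm adaptedD(1)[OF b(3) b(2)] sT by auto
  have meas: "S (Suc m) \<in> borel_measurable (F ?t)" unfolding S_Suc by measurable
  have PM [measurable]: "S m \<in> borel_measurable P" "h m \<in> borel_measurable P"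
    using measurable_from_subalg[OF sub(1)] IH(1) hm by auto
  show ?case
  proof (cases "?s = ?t")
    case True
    then have "S (Suc m) = S m" unfolding S_Suc by auto
    then show ?thesis using IH meas True by simp
  next
    case False
    then have st: "0 \<le> ?s" "?s < ?t" "?t \<le> T" using le by auto
    note mom = increment_moments[OF bm st]
    have hint: "integrable P (\<lambda>\<omega>. (h m \<omega>)\<^sup>2)"
      by (rule integrable_bounded_square[OF PM(2) B])
    have Sint: "integrable P (S m)"
      by (rule square_integrable_imp_integrable[OF PM(1) IH(2)])
    have Shint: "integrable P (\<lambda>\<omega>. S m \<omega> * h m \<omega>)"
    proof (rule Bochner_Integration.integrable_bound[where f="\<lambda>\<omega>. B * S m \<omega>"])
      show "AE \<omega> in P. norm (S m \<omega> * h m \<omega>) \<le> norm (B * S m \<omega>)"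
      proof (rule AE_I2)
        fix \<omega> assume "\<omega> \<in> space P"
        then have "\<bar>S m \<omega>\<bar> * \<bar>h m \<omega>\<bar> \<le> \<bar>S m \<omega>\<bar> * \<bar>B\<bar>"
          using B[of \<omega>] by (intro mult_left_mono) auto
        then show "norm (S m \<omega> * h m \<omega>) \<le> norm (B * S m \<omega>)"
          by (simp add: abs_mult mult.commute)
      qed
      show "integrable P (\<lambda>\<omega>. B * S m \<omega>)" using Sint by simp
    qed measurable
    have meas': "(\<lambda>\<omega>. S m \<omega> * h m \<omega>) \<in> borel_measurable (F ?s)"
        "(\<lambda>\<omega>. (h m \<omega>)\<^sup>2) \<in> borel_measurable (F ?s)"
      using IH(1) hm by measurable
    have meas2: "(\<lambda>x::real. x) \<in> borel_measurable borel" "(\<lambda>x::real. x\<^sup>2) \<in> borel_measurable borel"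
      by simp_all
    note c1 = increment_indep_integral[OF bm st meas'(1) Shint meas2(1) mom(1)]
    note c2 = increment_indep_integral[OF bm st meas'(2) hint meas2(2) mom(3)]
    have eq: "(\<lambda>\<omega>. (S (Suc m) \<omega>)\<^sup>2) =
        (\<lambda>\<omega>. (S m \<omega>)\<^sup>2 + 2 * (S m \<omega> * h m \<omega> * ?D \<omega>) + (h m \<omega>)\<^sup>2 * (?D \<omega>)\<^sup>2)"
      unfolding S_Suc by (auto simp: power2_eq_square algebra_simps)
    have "integrable P (\<lambda>\<omega>. (S (Suc m) \<omega>)\<^sup>2)"
      unfolding eq using IH(2) c1(1) c2(1)
      by (intro Bochner_Integration.integrable_add integrable_mult_right) auto
    moreover have "(\<integral>\<omega>. (S (Suc m) \<omega>)\<^sup>2 \<partial>P) =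
        (\<integral>\<omega>. (S m \<omega>)\<^sup>2 \<partial>P) + (\<integral>\<omega>. (h m \<omega>)\<^sup>2 \<partial>P) * (?t - ?s)"
      unfolding eq using IH(2) c1 c2 mom by simp
    ultimately show ?thesis using IH(3) meas by simp
  qed
qed


text \<open>The coefficients are truncated to \<open>k i\<close>, which is zero as soon as the energy \<open>V (Suc i)\<close>,
  already known at time \<open>\<tau> i\<close>, exceeds \<open>\<delta>\<close>. The truncated integrand has energy at most
  \<open>\<delta>\<close> on every path, so its integral \<open>S\<close> has second moment at most \<open>\<delta>\<close> and Markov's inequality
  gives the term \<open>\<delta> / \<epsilon>\<^sup>2\<close>. Where the total energy is at most \<open>\<delta>\<close>, nothing was truncated and
  the two integrals agree; the exceptional event is the other term.\<close>

lemma simple_integral_tail: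
  assumes bm: "brownian_motion P F T W"
    and mono: "\<And>s t. 0 \<le> s \<Longrightarrow> s \<le> t \<Longrightarrow> t \<le> T \<Longrightarrow> sets (F s) \<subseteq> sets (F t)"
    and si: "simple_integrand P F 0 T n \<tau> h" and u: "u \<in> {0..T}"
    and pos: "0 < \<epsilon>" "0 < \<delta>"
  shows "measure P {\<omega>\<in>space P. \<epsilon> < \<bar>simple_integral W n \<tau> h u \<omega>\<bar>} \<le>
    measure P {\<omega>\<in>space P. \<delta> < (\<Sum>i<n. (h i \<omega>)\<^sup>2 * (\<tau> (Suc i) - \<tau> i))} + \<delta> / \<epsilon>\<^sup>2"
proof -
  note b = brownian_motionD[OF bm]
  interpret prob_space P by (rule b)
  note d = simple_integrandD[OF si]
  note \<tau> = d(1-3) and \<tau>_mono = d(4) and \<tau>_in = d(5) and h = d(6,7)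
  define V where "V m \<omega> = (\<Sum>i<m. (h i \<omega>)\<^sup>2 * (\<tau> (Suc i) - \<tau> i))" for m \<omega>
  (* The condition \<tau> i < u makes k i known at the stopped time \<sigma> i below, which may lie
     before \<tau> i otherwise; the increments that it discards vanish anyway. *)
  define k where "k i \<omega> = (if \<tau> i < u \<and> V (Suc i) \<omega> \<le> \<delta> then h i \<omega> else 0)" for i \<omega>
  define \<sigma> where "\<sigma> i = min u (\<tau> i)" for i
  define S where "S \<omega> = (\<Sum>i<n. k i \<omega> * (W (\<sigma> (Suc i)) \<omega> - W (\<sigma> i) \<omega>))" for \<omega>
  have hF: "h j \<in> borel_measurable (F (\<tau> i))" if "j \<le> i" "i < n" for i j
    using that \<tau>_in[of i] \<tau>_in[of j] \<tau>_mono[of j i] h(1)[of j]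
    by (intro measurable_mono_filtration[OF b(2) b(2) mono, of "\<tau> j" "\<tau> i"]) auto
  have VF: "V (Suc i) \<in> borel_measurable (F (\<tau> i))" if "i < n" for i
    unfolding V_def using hF that
    by (intro borel_measurable_sum borel_measurable_times borel_measurable_power
        borel_measurable_const) auto
  have k\<tau>: "k i \<in> borel_measurable (F (\<tau> i))" if "i < n" for i
  proof -
    have [measurable]: "V (Suc i) \<in> borel_measurable (F (\<tau> i))" "h i \<in> borel_measurable (F (\<tau> i))"
      using VF[OF that] h(1)[OF that] by auto
    show ?thesis unfolding k_def by measurable
  qed
  have kF: "k i \<in> borel_measurable (F (\<sigma> i))" if "i < n" for i
  proof (cases "\<tau> i < u")
    case True
    then have "\<sigma> i = \<tau> i" by (simp add: \<sigma>_def)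
    then show ?thesis using k\<tau>[OF that] by simp
  next
    case False
    then have "k i = (\<lambda>_. 0)" by (auto simp: k_def)
    then show ?thesis by simp
  qed
  have kP: "k i \<in> borel_measurable P" if "i < n" for i
    using measurable_from_subalg[OF b(2) k\<tau>[OF that]] \<tau>_in[of i] that by simp
  have kB: "\<exists>B. \<forall>\<omega>\<in>space P. \<bar>k i \<omega>\<bar> \<le> B" if i: "i < n" for i
  proof -
    obtain B where B: "\<forall>\<omega>\<in>space P. \<bar>h i \<omega>\<bar> \<le> B" using h(2)[OF i] by blast
    have "\<bar>k i \<omega>\<bar> \<le> max 0 B" if "\<omega> \<in> space P" for \<omega>
      using B[rule_format, OF that] abs_ge_zero[of "h i \<omega>"] by (auto simp: k_def)
    then show ?thesis by blast
  qed
  have \<sigma>: "\<sigma> i \<le> \<sigma> (Suc i)" if "i < n" for i using \<tau>(3)[OF that] by (auto simp: \<sigma>_def)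
  have \<sigma>_in: "\<sigma> i \<in> {0..T}" if "i \<le> n" for i using \<tau>_in[OF that] u by (auto simp: \<sigma>_def)
  have mom: "S \<in> borel_measurable (F (\<sigma> n))" "integrable P (\<lambda>\<omega>. (S \<omega>)\<^sup>2)"
    "(\<integral>\<omega>. (S \<omega>)\<^sup>2 \<partial>P) = (\<Sum>i<n. (\<integral>\<omega>. (k i \<omega>)\<^sup>2 \<partial>P) * (\<sigma> (Suc i) - \<sigma> i))"
    using simple_sum_second_moment[of P F T W n \<sigma> k n, OF bm mono \<sigma> \<sigma>_in kF kB order_refl]
    unfolding S_def[abs_def] by auto
  have [measurable]: "S \<in> borel_measurable P"
    using measurable_from_subalg[OF b(2) mom(1)] \<sigma>_in[of n] by simp
  have kint: "integrable P (\<lambda>\<omega>. (k i \<omega>)\<^sup>2)" if i: "i < n" for i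
  proof -
    obtain B where B: "\<And>\<omega>. \<omega> \<in> space P \<Longrightarrow> \<bar>k i \<omega>\<bar> \<le> B" using kB[OF i] by blast
    then show ?thesis by (rule integrable_bounded_square[OF kP[OF i]])
  qed
  (* The bound V m carries the induction across an index at which the energy is still below \<delta>. *)
  have trunc: "(\<Sum>i<m. (k i \<omega>)\<^sup>2 * (\<sigma> (Suc i) - \<sigma> i)) \<le> min \<delta> (V m \<omega>)" if "m \<le> n" for m \<omega>
    using that
  proof (induction m)
    case 0
    then show ?case using pos by (simp add: V_def)
  next
    case (Suc m)
    have d: "0 \<le> \<tau> (Suc m) - \<tau> m" "\<sigma> (Suc m) - \<sigma> m \<le> \<tau> (Suc m) - \<tau> m"
      using \<tau>(3)[of m] Suc.prems by (auto simp: \<sigma>_def min_def)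
    have step: "V (Suc m) \<omega> = V m \<omega> + (h m \<omega>)\<^sup>2 * (\<tau> (Suc m) - \<tau> m)" by (simp add: V_def)
    have ge: "V m \<omega> \<le> V (Suc m) \<omega>" using d unfolding step by simp
    show ?case
    proof (cases "\<tau> m < u \<and> V (Suc m) \<omega> \<le> \<delta>")
      case True
      have "(k m \<omega>)\<^sup>2 * (\<sigma> (Suc m) - \<sigma> m) \<le> (h m \<omega>)\<^sup>2 * (\<tau> (Suc m) - \<tau> m)"
        using True d by (auto simp: k_def intro!: mult_left_mono)
      then show ?thesis using Suc step True by auto
    next
      case False
      then have "k m \<omega> = 0" by (auto simp: k_def)
      then show ?thesis using Suc ge by auto
    qed
  qed
  have "(\<integral>\<omega>. (S \<omega>)\<^sup>2 \<partial>P) = (\<integral>\<omega>. (\<Sum>i<n. (k i \<omega>)\<^sup>2 * (\<sigma> (Suc i) - \<sigma> i)) \<partial>P)"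
    unfolding mom(3) using kint by (subst Bochner_Integration.integral_sum) auto
  also have "\<dots> \<le> (\<integral>\<omega>. \<delta> \<partial>P)"
    using kint trunc[OF order_refl] by (intro integral_mono) auto
  finally have ES: "(\<integral>\<omega>. (S \<omega>)\<^sup>2 \<partial>P) \<le> \<delta>" by (simp add: prob_space)
  have Markov: "prob {\<omega>\<in>space P. \<epsilon>\<^sup>2 \<le> (S \<omega>)\<^sup>2} \<le> \<delta> / \<epsilon>\<^sup>2"
  proof -
    have "prob {\<omega>\<in>space P. \<epsilon>\<^sup>2 \<le> (S \<omega>)\<^sup>2} \<le> (\<integral>\<omega>. (S \<omega>)\<^sup>2 \<partial>P) / \<epsilon>\<^sup>2"
      using pos by (intro integral_Markov_inequality_measure[where A="{}"] mom(2)) auto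
    then show ?thesis using ES divide_right_mono[OF ES, of "\<epsilon>\<^sup>2"] by simp
  qed
  have hP: "h i \<in> borel_measurable P" if "i < n" for i
    using measurable_from_subalg[OF b(2) h(1)[OF that]] \<tau>_in[of i] that by simp
  have [measurable]: "V n \<in> borel_measurable P"
    unfolding V_def using hP
    by (intro borel_measurable_sum borel_measurable_times borel_measurable_power
        borel_measurable_const) auto
  have same: "simple_integral W n \<tau> h u \<omega> = S \<omega>" if Vn: "V n \<omega> \<le> \<delta>" for \<omega>
    unfolding simple_integral_def S_def
  proof (rule sum.cong[OF refl])
    fix i assume "i \<in> {..<n}"
    then have i: "i < n" by simp
    have "V (Suc i) \<omega> \<le> V n \<omega>"
      unfolding V_def using i \<tau>(3) by (intro sum_mono2) auto
    then have "k i \<omega> = (if \<tau> i < u then h i \<omega> else 0)" using Vn by (simp add: k_def)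
    then show "h i \<omega> * (W (min u (\<tau> (Suc i))) \<omega> - W (min u (\<tau> i)) \<omega>) =
        k i \<omega> * (W (\<sigma> (Suc i)) \<omega> - W (\<sigma> i) \<omega>)"
      using \<tau>(3)[OF i] by (auto simp: \<sigma>_def min_def)
  qed
  have "{\<omega>\<in>space P. \<epsilon> < \<bar>simple_integral W n \<tau> h u \<omega>\<bar>} \<subseteq>
      {\<omega>\<in>space P. \<delta> < V n \<omega>} \<union> {\<omega>\<in>space P. \<epsilon>\<^sup>2 \<le> (S \<omega>)\<^sup>2}"
  proof
    fix \<omega> assume \<omega>: "\<omega> \<in> {\<omega>\<in>space P. \<epsilon> < \<bar>simple_integral W n \<tau> h u \<omega>\<bar>}"
    show "\<omega> \<in> {\<omega>\<in>space P. \<delta> < V n \<omega>} \<union> {\<omega>\<in>space P. \<epsilon>\<^sup>2 \<le> (S \<omega>)\<^sup>2}"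
    proof (cases "\<delta> < V n \<omega>")
      case False
      then have "\<epsilon> \<le> \<bar>S \<omega>\<bar>" using \<omega> same[of \<omega>] by simp
      then have "\<epsilon>\<^sup>2 \<le> (S \<omega>)\<^sup>2" using pos power_mono[of \<epsilon> "\<bar>S \<omega>\<bar>" 2] by simp
      then show ?thesis using \<omega> by simp
    qed (use \<omega> in simp)
  qed
  then have "prob {\<omega>\<in>space P. \<epsilon> < \<bar>simple_integral W n \<tau> h u \<omega>\<bar>} \<le>
      prob ({\<omega>\<in>space P. \<delta> < V n \<omega>} \<union> {\<omega>\<in>space P. \<epsilon>\<^sup>2 \<le> (S \<omega>)\<^sup>2})"
    by (intro finite_measure_mono) auto
  also have "\<dots> \<le> prob {\<omega>\<in>space P. \<delta> < V n \<omega>} + prob {\<omega>\<in>space P. \<epsilon>\<^sup>2 \<le> (S \<omega>)\<^sup>2}"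
    by (intro measure_subadditive) auto
  finally show ?thesis using Markov unfolding V_def by simp
qed

lemma step_function_value:
  fixes \<tau> :: "nat \<Rightarrow> real"
  assumes \<tau>: "\<And>i. i < n \<Longrightarrow> \<tau> i \<le> \<tau> (Suc i)" and u: "\<tau> 0 < u" "u \<le> \<tau> n"
  obtains i where "i < n"
    "\<And>\<phi> :: nat \<Rightarrow> real. (\<Sum>j<n. \<phi> j * indicator {\<tau> j<..\<tau> (Suc j)} u) = \<phi> i"
proof -
  note \<tau>_mono = partition_mono[of n \<tau>, OF \<tau>]
  define m where "m = (LEAST k. u \<le> \<tau> k)"
  have m: "u \<le> \<tau> m" "m \<le> n" unfolding m_def using u by (auto intro: LeastI Least_le)
  then obtain i where i: "m = Suc i" using u by (cases m) auto
  then have "\<not> u \<le> \<tau> i" using not_less_Least[of i "\<lambda>k. u \<le> \<tau> k"] unfolding m_def by simp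
  then have ui: "\<tau> i < u" "u \<le> \<tau> (Suc i)" "i < n" using m i by auto
  have "indicator {\<tau> j<..\<tau> (Suc j)} u = (if j = i then 1 else (0::real))" if "j < n" for j
    using ui that \<tau>_mono[of "Suc j" i] \<tau>_mono[of "Suc i" j] not_less_eq_eq[of j i]
    by (cases j i rule: linorder_cases) (auto simp: indicator_def)
  then have "(\<Sum>j<n. \<phi> j * indicator {\<tau> j<..\<tau> (Suc j)} u) = \<phi> i" for \<phi> :: "nat \<Rightarrow> real"
    using ui(3) by (simp add: if_distrib[of "(*) _"] sum.delta cong: if_cong)
  then show ?thesis using that ui(3) by blast
qed

text \<open>The left end point \<open>a\<close> belongs to none of the half-open intervals of a simple process, so the
  integrand there is \<open>c\<^sup>2\<close> instead of a squared coefficient difference; it is a null set.\<close>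

lemma LBINT_simple_process_minus_const:
  assumes si: "simple_integrand P F a b n \<tau> h"
  shows "(LBINT u:{a..b}. (simple_process n \<tau> h u \<omega> - c)\<^sup>2) =
    (\<Sum>i<n. (h i \<omega> - c)\<^sup>2 * (\<tau> (Suc i) - \<tau> i))"
proof -
  note \<tau> = simple_integrandD(1-3)[OF si] and \<tau>_mono = simple_integrandD(4)[OF si]
  have eq: "indicator {a..b} u *\<^sub>R (simple_process n \<tau> h u \<omega> - c)\<^sup>2 =
      (\<Sum>i<n. (h i \<omega> - c)\<^sup>2 * indicator {\<tau> i<..\<tau> (Suc i)} u)" if "u \<noteq> a" for u
  proof (cases "u \<in> {a<..b}")
    case True
    then obtain i where
      "\<And>\<phi> :: nat \<Rightarrow> real. (\<Sum>j<n. \<phi> j * indicator {\<tau> j<..\<tau> (Suc j)} u) = \<phi> i"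
      using step_function_value[of n \<tau> u, OF \<tau>(3)] \<tau>(1,2) by (metis greaterThanAtMost_iff)
    then show ?thesis using True by (simp add: simple_process_def)
  next
    case False
    have "indicator {\<tau> i<..\<tau> (Suc i)} u = (0::real)" if "i < n" for i
      using False that \<tau> \<tau>_mono[of 0 i] \<tau>_mono[of "Suc i" n] by (auto simp: indicator_def)
    then have "(\<Sum>i<n. (h i \<omega> - c)\<^sup>2 * indicator {\<tau> i<..\<tau> (Suc i)} u) = 0"
      by (intro sum.neutral) auto
    moreover have "indicator {a..b} u = (0::real)" using False that by (auto simp: indicator_def)
    ultimately show ?thesis by simp
  qed
  have [measurable]: "(\<lambda>u. simple_process n \<tau> h u \<omega>) \<in> borel_measurable borel"
    unfolding simple_process_def by measurable
  have "(LBINT u:{a..b}. (simple_process n \<tau> h u \<omega> - c)\<^sup>2) =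
      (\<integral>u. (\<Sum>i<n. (h i \<omega> - c)\<^sup>2 * indicator {\<tau> i<..\<tau> (Suc i)} u) \<partial>lborel)"
    unfolding set_lebesgue_integral_def
  proof (rule integral_cong_AE)
    show "AE u in lborel. indicator {a..b} u *\<^sub>R (simple_process n \<tau> h u \<omega> - c)\<^sup>2 =
        (\<Sum>i<n. (h i \<omega> - c)\<^sup>2 * indicator {\<tau> i<..\<tau> (Suc i)} u)"
      using AE_lborel_singleton[of a] eq by (auto elim!: eventually_mono)
  qed measurable
  also have "\<dots> = (\<Sum>i<n. (h i \<omega> - c)\<^sup>2 * (\<tau> (Suc i) - \<tau> i))"
    using \<tau>(3) by (subst Bochner_Integration.integral_sum) auto
  finally show ?thesis .
qed

section \<open>Ito integrals of constants\<close>

text \<open>Two limits can only differ by more than \<open>2 * \<epsilon>\<close> where the approximation is off by more than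
  \<open>\<epsilon>\<close> from one of them.\<close>

lemma tendsto_in_prob_unique:
  assumes "prob_space P" and [measurable]: "\<And>k. X k \<in> borel_measurable P"
    "Y \<in> borel_measurable P" "Z \<in> borel_measurable P"
    and Y: "tendsto_in_prob P X Y" and Z: "tendsto_in_prob P X Z"
  shows "AE \<omega> in P. Y \<omega> = Z \<omega>"
proof -
  interpret prob_space P by fact
  have zero: "prob {\<omega>\<in>space P. 2 * \<epsilon> < \<bar>Y \<omega> - Z \<omega>\<bar>} = 0" if \<epsilon>: "0 < \<epsilon>" for \<epsilon>
  proof -
    have le: "prob {\<omega>\<in>space P. 2 * \<epsilon> < \<bar>Y \<omega> - Z \<omega>\<bar>} \<le>
        prob {\<omega>\<in>space P. \<epsilon> < \<bar>X k \<omega> - Y \<omega>\<bar>} + prob {\<omega>\<in>space P. \<epsilon> < \<bar>X k \<omega> - Z \<omega>\<bar>}" for k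
    proof -
      have "prob {\<omega>\<in>space P. 2 * \<epsilon> < \<bar>Y \<omega> - Z \<omega>\<bar>} \<le>
          prob ({\<omega>\<in>space P. \<epsilon> < \<bar>X k \<omega> - Y \<omega>\<bar>} \<union> {\<omega>\<in>space P. \<epsilon> < \<bar>X k \<omega> - Z \<omega>\<bar>})"
        by (rule finite_measure_mono) auto
      also have "\<dots> \<le> prob {\<omega>\<in>space P. \<epsilon> < \<bar>X k \<omega> - Y \<omega>\<bar>} + prob {\<omega>\<in>space P. \<epsilon> < \<bar>X k \<omega> - Z \<omega>\<bar>}"
        by (rule measure_subadditive) auto
      finally show ?thesis .
    qed
    have "(\<lambda>k. prob {\<omega>\<in>space P. \<epsilon> < \<bar>X k \<omega> - Y \<omega>\<bar>} + prob {\<omega>\<in>space P. \<epsilon> < \<bar>X k \<omega> - Z \<omega>\<bar>})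
        \<longlonglongrightarrow> 0 + 0"
      using Y Z \<epsilon> unfolding tendsto_in_prob_def by (intro tendsto_add) auto
    then have "prob {\<omega>\<in>space P. 2 * \<epsilon> < \<bar>Y \<omega> - Z \<omega>\<bar>} \<le> 0"
      using le by (intro LIMSEQ_le_const) auto
    then show ?thesis by (simp add: measure_le_0_iff)
  qed
  have "AE \<omega> in P. \<not> 2 * (1 / real (Suc n)) < \<bar>Y \<omega> - Z \<omega>\<bar>" for n
    using zero[of "1 / real (Suc n)"] by (subst AE_iff_measurable[OF _ refl]) (auto simp: emeasure_eq_measure)
  then have "AE \<omega> in P. \<forall>n. \<not> 2 * (1 / real (Suc n)) < \<bar>Y \<omega> - Z \<omega>\<bar>"
    by (simp add: AE_all_countable)
  then show ?thesis
  proof eventually_elim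
    case (elim \<omega>)
    show ?case
    proof (rule ccontr)
      assume "Y \<omega> \<noteq> Z \<omega>"
      then have "0 < \<bar>Y \<omega> - Z \<omega>\<bar> / 2" by simp
      then obtain n where "inverse (real (Suc n)) < \<bar>Y \<omega> - Z \<omega>\<bar> / 2"
        using reals_Archimedean by blast
      then show False using elim[rule_format, of n] by (simp add: inverse_eq_divide)
    qed
  qed
qed

lemma continuous_modification_indistinguishable:
  assumes T: "0 \<le> T" and X: "continuous_paths P 0 T X" and Y: "continuous_paths P 0 T Y"
    and eq: "\<And>t. t \<in> {0..T} \<Longrightarrow> AE \<omega> in P. X t \<omega> = Y t \<omega>"
  shows "AE \<omega> in P. \<forall>t\<in>{0..T}. X t \<omega> = Y t \<omega>"
proof -
  (* Clamping the time to [0,T] turns the paths into continuous functions on the whole line,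
     where agreement on the rationals suffices. *)
  define cl where "cl = (\<lambda>q::real. max 0 (min q T))"
  have cl_in: "cl q \<in> {0..T}" for q using T by (auto simp: cl_def)
  have "AE \<omega> in P. \<forall>q\<in>\<rat>. X (cl q) \<omega> = Y (cl q) \<omega>"
    using eq[OF cl_in] countable_rat by (subst AE_ball_countable) auto
  with X Y show ?thesis
    unfolding continuous_paths_def
  proof eventually_elim
    case (elim \<omega>)
    have cl: "continuous_on UNIV cl" unfolding cl_def by (intro continuous_intros)
    have "continuous_on UNIV (\<lambda>q. X (cl q) \<omega>)" "continuous_on UNIV (\<lambda>q. Y (cl q) \<omega>)"
      using elim(1,2) cl_in by (auto intro!: continuous_on_compose2[OF _ cl])
    then have "continuous_on (closure \<rat>) (\<lambda>q. X (cl q) \<omega> - Y (cl q) \<omega>)"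
      by (auto intro: continuous_on_diff simp: Rats_closure_real)
    then have z: "X (cl q) \<omega> - Y (cl q) \<omega> = 0" for q
      by (rule continuous_constant_on_closure) (use elim(3) in \<open>auto simp: Rats_closure_real\<close>)
    show ?case
    proof
      fix t assume "t \<in> {0..T}"
      then have "cl t = t" by (auto simp: cl_def)
      then show "X t \<omega> = Y t \<omega>" using z[of t] by simp
    qed
  qed
qed

text \<open>Subtracting \<open>c\<close> from every coefficient of an approximating simple integrand gives a simple
  integrand whose energy is the approximation error and whose integral is the approximating
  integral minus \<open>c * (W u - W 0)\<close>. The tail estimate turns the convergence of the former to
  zero into that of the latter, so \<open>c * W u\<close> is a limit of the approximating integrals, too.\<close>

lemma ito_integral_const_unique:
  assumes bm: "brownian_motion P F T W" and T: "0 \<le> T"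
    and mono: "\<And>s t. 0 \<le> s \<Longrightarrow> s \<le> t \<Longrightarrow> t \<le> T \<Longrightarrow> sets (F s) \<subseteq> sets (F t)"
    and I: "ito_integral P F W 0 T H I" and H: "\<And>u \<omega>. u \<in> {0..T} \<Longrightarrow> H u \<omega> = c"
  shows "AE \<omega> in P. \<forall>u\<in>{0..T}. I u \<omega> = c * W u \<omega>"
proof -
  note b = brownian_motionD[OF bm]
  interpret prob_space P by (rule b)
  have ad: "adapted F 0 T I" and cont: "continuous_paths P 0 T I"
    using I unfolding ito_integral_def by auto
  obtain n \<tau> h where si: "\<And>k. simple_integrand P F 0 T (n k) (\<tau> k) (h k)"
    and app: "tendsto_in_prob P
      (\<lambda>k \<omega>. LBINT u:{0..T}. (simple_process (n k) (\<tau> k) (h k) u \<omega> - H u \<omega>)\<^sup>2) (\<lambda>\<omega>. 0)"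
    and lim: "\<And>u. u \<in> {0..T} \<Longrightarrow>
      tendsto_in_prob P (\<lambda>k. simple_integral W (n k) (\<tau> k) (h k) u) (I u)"
    using I unfolding ito_integral_def by blast
  define V where "V k \<omega> = (\<Sum>i<n k. (h k i \<omega> - c)\<^sup>2 * (\<tau> k (Suc i) - \<tau> k i))" for k \<omega>
  have "(LBINT u:{0..T}. (simple_process (n k) (\<tau> k) (h k) u \<omega> - H u \<omega>)\<^sup>2) = V k \<omega>" for k \<omega>
    unfolding V_def LBINT_simple_process_minus_const[OF si, symmetric]
    by (intro set_lebesgue_integral_cong) (auto simp: H)
  then have app': "tendsto_in_prob P V (\<lambda>\<omega>. 0)" using app by simp
  have V_nonneg: "0 \<le> V k \<omega>" for k \<omega>
    using si[of k] unfolding V_def simple_integrand_def by (intro sum_nonneg) auto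
  have si': "simple_integrand P F 0 T (n k) (\<tau> k) (\<lambda>i \<omega>. h k i \<omega> - c)" for k
    unfolding simple_integrand_def
  proof (intro conjI allI impI)
    fix i assume i: "i < n k"
    have "h k i \<in> borel_measurable (F (\<tau> k i))" by (rule simple_integrandD(6)[OF si i])
    then show "(\<lambda>\<omega>. h k i \<omega> - c) \<in> borel_measurable (F (\<tau> k i))" by measurable
    obtain B where B: "\<forall>\<omega>\<in>space P. \<bar>h k i \<omega>\<bar> \<le> B"
      using simple_integrandD(7)[OF si i] by blast
    have "\<bar>h k i \<omega> - c\<bar> \<le> B + \<bar>c\<bar>" if "\<omega> \<in> space P" for \<omega>
      using B[rule_format, OF that] by linarith
    then show "\<exists>B. \<forall>\<omega>\<in>space P. \<bar>h k i \<omega> - c\<bar> \<le> B" by blast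
  qed (use si[of k] in \<open>auto simp: simple_integrand_def\<close>)
  have diff: "simple_integral W (n k) (\<tau> k) (\<lambda>i \<omega>. h k i \<omega> - c) u \<omega> =
      simple_integral W (n k) (\<tau> k) (h k) u \<omega> - c * (W u \<omega> - W 0 \<omega>)" if u: "u \<in> {0..T}" for k u \<omega>
  proof -
    have "(\<Sum>i<n k. W (min u (\<tau> k (Suc i))) \<omega> - W (min u (\<tau> k i)) \<omega>) = W u \<omega> - W 0 \<omega>"
      using si[of k] u unfolding simple_integrand_def by (subst sum_lessThan_telescope) auto
    then show ?thesis
      unfolding simple_integral_def
      by (simp add: left_diff_distrib sum_subtractf sum_distrib_left[symmetric])
  qed
  have "AE \<omega> in P. I u \<omega> = c * W u \<omega>" if u: "u \<in> {0..T}" for u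
  proof -
    have meas: "I u \<in> borel_measurable P" "\<And>v. v \<in> {0..T} \<Longrightarrow> W v \<in> borel_measurable P"
      using adaptedD(2)[OF ad b(2) u] adaptedD(2)[OF b(3) b(2)] by auto
    have zT: "0 \<in> {0..T}" using T by simp
    note [measurable] = meas(1) meas(2)[OF u] meas(2)[OF zT]
    have sm: "simple_integral W (n k) (\<tau> k) (h k) u \<in> borel_measurable P" for k
    proof -
      note in_T = simple_integrandD(5)[OF si[of k]]
      have hk: "h k i \<in> borel_measurable P" if "i < n k" for i
        using simple_integrandD(6)[OF si[of k] that] in_T[of i] that
        by (intro measurable_from_subalg[OF b(2), of "\<tau> k i"]) auto
      have "W (min u (\<tau> k i)) \<in> borel_measurable P" if "i \<le> n k" for i
        using u in_T[OF that] by (intro meas(2)) auto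
      then show ?thesis
        unfolding simple_integral_def using hk
        by (intro borel_measurable_sum borel_measurable_times borel_measurable_diff) auto
    qed
    have "tendsto_in_prob P (\<lambda>k. simple_integral W (n k) (\<tau> k) (h k) u) (\<lambda>\<omega>. c * (W u \<omega> - W 0 \<omega>))"
      unfolding tendsto_in_prob_def
    proof (intro allI impI LIMSEQ_I)
      fix \<epsilon> r :: real assume pos: "0 < \<epsilon>" "0 < r"
      (* Chosen so that both terms of the tail estimate are at most r / 2. *)
      define \<delta> where "\<delta> = \<epsilon>\<^sup>2 * r / 2"
      have \<delta>: "0 < \<delta>" "\<delta> / \<epsilon>\<^sup>2 = r / 2" using pos by (auto simp: \<delta>_def)
      have "(\<lambda>k. prob {\<omega>\<in>space P. \<delta> < V k \<omega>}) \<longlonglongrightarrow> 0"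
        using app' \<delta> V_nonneg unfolding tendsto_in_prob_def by simp
      then obtain K where K: "\<And>k. K \<le> k \<Longrightarrow> prob {\<omega>\<in>space P. \<delta> < V k \<omega>} < r / 2"
        using LIMSEQ_D[of _ 0 "r / 2"] pos by fastforce
      have "prob {\<omega>\<in>space P. \<epsilon> < \<bar>simple_integral W (n k) (\<tau> k) (h k) u \<omega> - c * (W u \<omega> - W 0 \<omega>)\<bar>} < r"
        if "K \<le> k" for k
        using simple_integral_tail[OF bm mono si' u pos(1) \<delta>(1), of k] K[OF that] \<delta>(2)
        unfolding diff[OF u] V_def[symmetric] by simp
      then show "\<exists>K. \<forall>k\<ge>K. norm (prob {\<omega>\<in>space P.
          \<epsilon> < \<bar>simple_integral W (n k) (\<tau> k) (h k) u \<omega> - c * (W u \<omega> - W 0 \<omega>)\<bar>} - 0) < r"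
        by auto
    qed
    from tendsto_in_prob_unique[OF prob_space_axioms sm _ _ lim[OF u] this]
    have "AE \<omega> in P. I u \<omega> = c * (W u \<omega> - W 0 \<omega>)" by simp
    with b(5) show ?thesis by eventually_elim simp
  qed
  moreover have "continuous_paths P 0 T (\<lambda>u \<omega>. c * W u \<omega>)"
    using b(4) unfolding continuous_paths_def by eventually_elim (intro continuous_intros)
  ultimately show ?thesis
    using continuous_modification_indistinguishable[OF T cont] by blast
qed


lemma ito_integral_const:
  assumes bm: "brownian_motion P F T W" and T: "0 \<le> T"
  shows "ito_integral P F W 0 T (\<lambda>u \<omega>. c) (\<lambda>u \<omega>. c * W u \<omega>)"
proof -
  note b = brownian_motionD[OF bm]
  interpret prob_space P by (rule b)
  (* A constant is itself simple, up to its value at time 0: one interval from 0 to T. *)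
  let ?n = "1 :: nat" and ?\<tau> = "\<lambda>i. if i = 0 then 0 else T" and ?h = "\<lambda>_ _. c"
  have si: "simple_integrand P F 0 T ?n ?\<tau> ?h"
    using T unfolding simple_integrand_def by auto
  have int: "set_integrable lborel {0..T} (\<lambda>u. c\<^sup>2)"
    unfolding set_integrable_def using T by (simp add: integrable_real_mult_indicator)
  have "adapted F 0 T (\<lambda>u \<omega>. c * W u \<omega>)"
    using b(3) unfolding adapted_def by auto
  moreover have "continuous_paths P 0 T (\<lambda>u \<omega>. c * W u \<omega>)"
    using b(4) unfolding continuous_paths_def by eventually_elim (intro continuous_intros)
  moreover have "tendsto_in_prob P
      (\<lambda>k \<omega>. LBINT u:{0..T}. (simple_process ?n ?\<tau> ?h u \<omega> - c)\<^sup>2) (\<lambda>\<omega>. 0)"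
    unfolding LBINT_simple_process_minus_const[OF si] by (simp add: tendsto_in_prob_def)
  moreover have "tendsto_in_prob P (\<lambda>k. simple_integral W ?n ?\<tau> ?h u) (\<lambda>\<omega>. c * W u \<omega>)"
    if u: "u \<in> {0..T}" for u
  proof -
    have "AE \<omega> in P. simple_integral W ?n ?\<tau> ?h u \<omega> - c * W u \<omega> = 0"
      using b(5) by eventually_elim (use u in \<open>simp add: simple_integral_def\<close>)
    moreover have "simple_integral W ?n ?\<tau> ?h u \<omega> = c * (W u \<omega> - W 0 \<omega>)" for \<omega>
      using u by (simp add: simple_integral_def)
    moreover have "W u \<in> borel_measurable P" "W 0 \<in> borel_measurable P"
      using adaptedD(2)[OF b(3) b(2)] u T by auto
    ultimately have "prob {\<omega>\<in>space P. \<epsilon> < \<bar>simple_integral W ?n ?\<tau> ?h u \<omega> - c * W u \<omega>\<bar>} = prob {}"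
      if "0 < \<epsilon>" for \<epsilon>
      using that by (intro finite_measure_eq_AE) auto
    then show ?thesis unfolding tendsto_in_prob_def by simp
  qed
  ultimately show ?thesis
    unfolding ito_integral_def progressive_def using si int
    by (intro conjI exI[of _ "\<lambda>_. ?n"] exI[of _ "\<lambda>_. ?\<tau>"] exI[of _ "\<lambda>_. ?h"]) auto
qed

section \<open>Girsanov's theorem for a constant kernel\<close>

text \<open>The stochastic (Doleans-Dade) exponential of \<open>c * W\<close>, with extended nonnegative values so that
  it can serve as a density.\<close>

definition exp_density :: "'a process \<Rightarrow> real \<Rightarrow> real \<Rightarrow> 'a \<Rightarrow> ennreal" where
  "exp_density W c t \<omega> = ennreal (exp (c * W t \<omega> - c\<^sup>2 * t / 2))"

lemma exp_density_measurable:
  assumes "W t \<in> borel_measurable N"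
  shows "exp_density W c t \<in> borel_measurable N"
proof -
  note [measurable] = assms
  show ?thesis unfolding exp_density_def[abs_def] by measurable
qed

text \<open>Completing the square: \<open>- x\<^sup>2 / (2 d) + c x - c\<^sup>2 d / 2 = - (x - c d)\<^sup>2 / (2 d)\<close>. The tilted density
  is that of the Gaussian with mean \<open>c d\<close>, and the shift in \<open>g\<close> centres it again.\<close>

lemma gaussian_tilt:
  assumes d: "0 < d" and g [measurable]: "g \<in> borel_measurable borel"
  shows "(\<integral>\<^sup>+x. ennreal (normal_density 0 (sqrt d) x) *
      (ennreal (exp (c * x - c\<^sup>2 * d / 2)) * g (x - c * d)) \<partial>lborel) =
    (\<integral>\<^sup>+x. ennreal (normal_density 0 (sqrt d) x) * g x \<partial>lborel)"
proof -
  have eq: "normal_density 0 (sqrt d) (c * d + x) * exp (c * (c * d + x) - c\<^sup>2 * d / 2) =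
      normal_density 0 (sqrt d) x" for x
  proof -
    have "- ((c * d + x)\<^sup>2) / (2 * d) + (c * (c * d + x) - c\<^sup>2 * d / 2) = - (x\<^sup>2) / (2 * d)"
      using d by (simp add: field_simps power2_eq_square)
    then show ?thesis
      using d unfolding normal_density_def by (simp add: mult_exp_exp)
  qed
  have "(\<integral>\<^sup>+x. ennreal (normal_density 0 (sqrt d) x) *
      (ennreal (exp (c * x - c\<^sup>2 * d / 2)) * g (x - c * d)) \<partial>lborel) =
      (\<integral>\<^sup>+x. ennreal (normal_density 0 (sqrt d) (c * d + x)) *
      (ennreal (exp (c * (c * d + x) - c\<^sup>2 * d / 2)) * g x) \<partial>lborel)"
    by (subst nn_integral_real_affine[where t="c * d" and c=1]) auto
  also have "\<dots> = (\<integral>\<^sup>+x. ennreal (normal_density 0 (sqrt d) x) * g x \<partial>lborel)"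
    by (simp add: mult.assoc[symmetric] ennreal_mult[symmetric] eq)
  finally show ?thesis .
qed

text \<open>The core of Girsanov's theorem. The exponential at time \<open>t\<close> is the one at time \<open>s\<close> times a
  function of the increment of \<open>W\<close>; independence splits the integral, and the Gaussian tilt removes
  the second exponential together with the drift.\<close>

lemma exp_density_increment:
  assumes bm: "brownian_motion P F T W" and st: "0 \<le> s" "s < t" "t \<le> T"
    and A: "A \<in> sets (F s)" and g [measurable]: "g \<in> borel_measurable borel"
  shows "(\<integral>\<^sup>+\<omega>. exp_density W c t \<omega> *
      (indicator A \<omega> * g ((W t \<omega> - c * t) - (W s \<omega> - c * s))) \<partial>P) =
    (\<integral>\<^sup>+\<omega>. exp_density W c s \<omega> * indicator A \<omega> \<partial>P) *
    (\<integral>\<^sup>+x. ennreal (normal_density 0 (sqrt (t - s)) x) * g x \<partial>lborel)"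
proof -
  note b = brownian_motionD[OF bm]
  have X: "(\<lambda>\<omega>. exp_density W c s \<omega> * indicator A \<omega>) \<in> borel_measurable (F s)"
    using A st
    by (intro borel_measurable_times_ennreal borel_measurable_indicator
        exp_density_measurable adaptedD(1)[OF b(3) b(2)]) auto
  have fac: "exp_density W c t \<omega> *
      (indicator A \<omega> * g ((W t \<omega> - c * t) - (W s \<omega> - c * s))) =
      exp_density W c s \<omega> * indicator A \<omega> *
      (ennreal (exp (c * (W t \<omega> - W s \<omega>) - c\<^sup>2 * (t - s) / 2)) *
        g ((W t \<omega> - W s \<omega>) - c * (t - s)))" for \<omega>
  proof -
    have "c * W t \<omega> - c\<^sup>2 * t / 2 =
        (c * W s \<omega> - c\<^sup>2 * s / 2) + (c * (W t \<omega> - W s \<omega>) - c\<^sup>2 * (t - s) / 2)"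
      by (simp add: field_simps)
    then have "exp_density W c t \<omega> = exp_density W c s \<omega> *
        ennreal (exp (c * (W t \<omega> - W s \<omega>) - c\<^sup>2 * (t - s) / 2))"
      unfolding exp_density_def by (simp add: exp_add ennreal_mult)
    moreover have "(W t \<omega> - c * t) - (W s \<omega> - c * s) = (W t \<omega> - W s \<omega>) - c * (t - s)"
      by (simp add: algebra_simps)
    ultimately show ?thesis by (simp only: mult_ac)
  qed
  show ?thesis
    unfolding fac
    using st by (subst increment_nn_integral[OF bm st X]) (simp_all add: gaussian_tilt)
qed

lemma exp_density_martingale:
  assumes bm: "brownian_motion P F T W" and st: "0 \<le> s" "s \<le> t" "t \<le> T"
    and A: "A \<in> sets (F s)"
  shows "(\<integral>\<^sup>+\<omega>. exp_density W c t \<omega> * indicator A \<omega> \<partial>P) =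
    (\<integral>\<^sup>+\<omega>. exp_density W c s \<omega> * indicator A \<omega> \<partial>P)"
proof (cases "s = t")
  case False
  then have st: "0 \<le> s" "s < t" "t \<le> T" using assms by auto
  interpret N: prob_space "density lborel (normal_density 0 (sqrt (t - s)))"
    using st by (intro prob_space_normal_density) simp
  have "(\<integral>\<^sup>+x. ennreal (normal_density 0 (sqrt (t - s)) x) * 1 \<partial>lborel) = 1"
    using N.emeasure_space_1 by (subst (asm) emeasure_density) auto
  then show ?thesis
    using exp_density_increment[OF bm st A, of "\<lambda>_. 1" c] by simp
qed simp

lemma exp_density_total:
  assumes bm: "brownian_motion P F T W" and "t \<in> {0..T}"
  shows "(\<integral>\<^sup>+\<omega>. exp_density W c t \<omega> \<partial>P) = 1"
proof -
  note b = brownian_motionD[OF bm]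
  interpret prob_space P by (rule b)
  have "space P \<in> sets (F 0)" using b(2)[of 0] assms sets.top[of "F 0"] by (auto simp: subalgebra_def)
  then have "(\<integral>\<^sup>+\<omega>. exp_density W c t \<omega> * indicator (space P) \<omega> \<partial>P) =
      (\<integral>\<^sup>+\<omega>. exp_density W c 0 \<omega> * indicator (space P) \<omega> \<partial>P)"
    using assms by (intro exp_density_martingale[OF bm]) auto
  also have "\<dots> = (\<integral>\<^sup>+\<omega>. 1 \<partial>P)"
    using b(5) by (intro nn_integral_cong_AE) (auto simp: exp_density_def)
  also have "\<dots> = 1" by (simp add: emeasure_space_1)
  also have "(\<integral>\<^sup>+\<omega>. exp_density W c t \<omega> * indicator (space P) \<omega> \<partial>P) = (\<integral>\<^sup>+\<omega>. exp_density W c t \<omega> \<partial>P)"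
    by (intro nn_integral_cong) simp
  finally show ?thesis .
qed

lemma continuous_paths_transfer:
  assumes "sets Q = sets P" "absolutely_continuous P Q" "continuous_paths P a b X"
  shows "continuous_paths Q a b X"
  using absolutely_continuous_AE[OF assms(1,2)] assms(3) unfolding continuous_paths_def by blast

text \<open>For \<open>A\<close> known at time \<open>s\<close>, integrating the density over \<open>A\<close> and the event that the increment of
  \<open>W\<^sub>t - c t\<close> lies in \<open>B\<close> gives \<open>Q A\<close> times the centred Gaussian measure of \<open>B\<close>. Taking the whole
  space for \<open>A\<close> identifies the law of the increment, and then the formula reads as independence
  of the past. Paths keep their almost sure properties by absolute continuity.\<close>

lemma brownian_motion_girsanov:
  assumes bm: "brownian_motion P F T W" and T: "0 \<le> T"
    and sets: "sets Q = sets P" and ac: "absolutely_continuous P Q"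
    and Q: "\<And>t A. t \<in> {0..T} \<Longrightarrow> A \<in> sets (F t) \<Longrightarrow>
      emeasure Q A = (\<integral>\<^sup>+\<omega>. exp_density W c t \<omega> * indicator A \<omega> \<partial>P)"
    and mono: "\<And>s t. 0 \<le> s \<Longrightarrow> s \<le> t \<Longrightarrow> t \<le> T \<Longrightarrow> sets (F s) \<subseteq> sets (F t)"
  shows "brownian_motion Q F T (\<lambda>t \<omega>. W t \<omega> - c * t)"
proof -
  note b = brownian_motionD[OF bm]
  have sp: "space Q = space P" using sets by (rule sets_eq_imp_space_eq)
  have spF: "space (F t) = space P" "space P \<in> sets (F t)" if "t \<in> {0..T}" for t
    using b(2)[OF that] sets.top[of "F t"] by (auto simp: subalgebra_def)
  have QA: "emeasure Q (space P) = 1"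
    using Q[of 0 "space P"] spF[of 0] exp_density_total[OF bm, of 0 c] T
    by (simp cong: nn_integral_cong_simp)
  interpret Q: prob_space Q by (rule prob_spaceI) (simp add: sp QA)
  have sub: "subalgebra Q (F t)" if "t \<in> {0..T}" for t
    using b(2)[OF that] sets sp by (simp add: subalgebra_def)
  have ad: "adapted F 0 T (\<lambda>t \<omega>. W t \<omega> - c * t)"
    using b(3) unfolding adapted_def by auto
  have incr: "distributed Q lborel (\<lambda>\<omega>. (W t \<omega> - c * t) - (W s \<omega> - c * s))
        (normal_density 0 (sqrt (t - s))) \<and>
      Q.indep_set (sets (F s))
        {(\<lambda>\<omega>. (W t \<omega> - c * t) - (W s \<omega> - c * s)) -` B \<inter> space Q | B. B \<in> sets borel}"
    if st: "0 \<le> s" "s < t" "t \<le> T" for s t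
  proof -
    let ?D = "\<lambda>\<omega>. (W t \<omega> - c * t) - (W s \<omega> - c * s)"
    let ?N = "density lborel (normal_density 0 (sqrt (t - s)))"
    have sT: "s \<in> {0..T}" and tT: "t \<in> {0..T}" using st by auto
    have le: "s \<le> t" using st by simp
    have up: "sets (F s) \<subseteq> sets (F t)" using mono[OF st(1) le st(3)] .
    have [measurable]: "W t \<in> borel_measurable (F t)" "W s \<in> borel_measurable (F t)"
      using adaptedD(1)[OF b(3) b(2) tT]
        measurable_mono_filtration[OF b(2)[OF sT] b(2)[OF tT] up adaptedD(1)[OF b(3) b(2) sT]]
      by auto
    have Dt: "?D \<in> borel_measurable (F t)" by measurable
    have DQ: "?D \<in> borel_measurable Q" by (rule measurable_from_subalg[OF sub[OF tT] Dt])
    have joint: "emeasure Q (A \<inter> (?D -` B \<inter> space Q)) = emeasure Q A * emeasure ?N B"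
      if A: "A \<in> sets (F s)" and B: "B \<in> sets borel" for A B
    proof -
      have Bt: "?D -` B \<inter> space P \<in> sets (F t)"
        using measurable_sets[OF Dt B] spF[OF tT] by simp
      have "emeasure Q (A \<inter> (?D -` B \<inter> space Q)) =
          (\<integral>\<^sup>+\<omega>. exp_density W c t \<omega> * indicator (A \<inter> (?D -` B \<inter> space P)) \<omega> \<partial>P)"
        unfolding sp using A up Bt by (intro Q[OF tT]) auto
      also have "\<dots> = (\<integral>\<^sup>+\<omega>. exp_density W c t \<omega> * (indicator A \<omega> * indicator B (?D \<omega>)) \<partial>P)"
        by (intro nn_integral_cong) (auto simp: indicator_def)
      also have "\<dots> = emeasure Q A * emeasure ?N B"
        using B by (subst exp_density_increment[OF bm st A])
          (simp_all add: Q[OF sT A] emeasure_density)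
      finally show ?thesis .
    qed
    have distr: "distr Q lborel ?D = ?N"
    proof (rule measure_eqI)
      fix B assume "B \<in> sets (distr Q lborel ?D)"
      then have B: "B \<in> sets borel" by simp
      have "emeasure (distr Q lborel ?D) B = emeasure Q (?D -` B \<inter> space Q)"
        using B DQ by (subst emeasure_distr) auto
      also have "?D -` B \<inter> space Q = space P \<inter> (?D -` B \<inter> space Q)" using sp by auto
      also have "emeasure Q \<dots> = emeasure ?N B"
        unfolding joint[OF spF(2)[OF sT] B] QA by simp
      finally show "emeasure (distr Q lborel ?D) B = emeasure ?N B" .
    qed simp
    have "Q.indep_set (sets (F s)) {?D -` B \<inter> space Q | B. B \<in> sets borel}"
      unfolding Q.indep_sets2_eq
    proof (intro conjI ballI)
      show "sets (F s) \<subseteq> sets Q" using sub[OF sT] by (simp add: subalgebra_def)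
      show "{?D -` B \<inter> space Q | B. B \<in> sets borel} \<subseteq> sets Q"
        using measurable_sets[OF DQ] by auto
      fix A C assume A: "A \<in> sets (F s)" and "C \<in> {?D -` B \<inter> space Q | B. B \<in> sets borel}"
      then obtain B where B: "B \<in> sets borel" "C = ?D -` B \<inter> space Q" by auto
      have "emeasure ?N B = emeasure Q C"
        unfolding distr[symmetric] B(2) using B(1) DQ by (subst emeasure_distr) auto
      then have "emeasure Q (A \<inter> C) = emeasure Q A * emeasure Q C"
        using joint[OF A B(1)] B(2) by simp
      then show "Q.prob (A \<inter> C) = Q.prob A * Q.prob C"
        by (simp add: measure_def enn2real_mult)
    qed
    then show ?thesis using distr DQ by (simp add: distributed_def)
  qed
  have "continuous_paths Q 0 T W" by (rule continuous_paths_transfer[OF sets ac b(4)])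
  then have "continuous_paths Q 0 T (\<lambda>t \<omega>. W t \<omega> - c * t)"
    unfolding continuous_paths_def by eventually_elim (intro continuous_intros)
  moreover have "AE \<omega> in Q. W 0 \<omega> - c * 0 = 0"
    using absolutely_continuous_AE[OF sets ac b(5)] by simp
  ultimately show ?thesis
    unfolding brownian_motion_def using Q.prob_space_axioms sub ad incr by blast
qed

text \<open>The density in the definition of \<open>girsanov_measure\<close> is formed with an arbitrary version of the
  Ito integral of the kernel; as all versions agree almost surely with \<open>c * W\<close>, it may be
  replaced by the explicit exponential.\<close>

lemma girsanov_measure_emeasure:
  assumes bm: "brownian_motion P F T W" and T: "0 \<le> T"
    and mono: "\<And>s t. 0 \<le> s \<Longrightarrow> s \<le> t \<Longrightarrow> t \<le> T \<Longrightarrow> sets (F s) \<subseteq> sets (F t)"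
    and Q: "girsanov_measure P F W T (\<lambda>_ _. c) Q"
    and t: "t \<in> {0..T}" and A: "A \<in> sets (F t)"
  shows "emeasure Q A = (\<integral>\<^sup>+\<omega>. exp_density W c t \<omega> * indicator A \<omega> \<partial>P)"
proof -
  note b = brownian_motionD[OF bm]
  obtain J where J: "ito_integral P F W 0 T (\<lambda>_ _. c) J"
    and dens: "restr_to_subalg Q (F t) = density (restr_to_subalg P (F t))
      (\<lambda>\<omega>. ennreal (exp (J t \<omega> - 1 / 2 * (LBINT s:{0..t}. c\<^sup>2))))"
    using Q t unfolding girsanov_measure_def by blast
  have sets: "sets Q = sets P" using Q by (simp add: girsanov_measure_def equivalent_measure_def)
  have subP: "subalgebra P (F t)" by (rule b(2)[OF t])
  have subQ: "subalgebra Q (F t)"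
    using subP sets sets_eq_imp_space_eq[OF sets] by (simp add: subalgebra_def)
  have "adapted F 0 T J" using J by (simp add: ito_integral_def)
  from adaptedD(1)[OF this b(2) t] have Jt [measurable]: "J t \<in> borel_measurable (F t)" .
  let ?Z = "\<lambda>\<omega>. ennreal (exp (J t \<omega> - 1 / 2 * (LBINT s:{0..t}. c\<^sup>2)))"
  have Z [measurable]: "?Z \<in> borel_measurable (F t)" by measurable
  have "emeasure Q A = emeasure (restr_to_subalg Q (F t)) A"
    by (rule emeasure_restr_to_subalg[OF subQ A, symmetric])
  also have "\<dots> = (\<integral>\<^sup>+\<omega>. ?Z \<omega> * indicator A \<omega> \<partial>restr_to_subalg P (F t))"
    unfolding dens using Z A measurable_in_subalg[OF subP Z] sets_restr_to_subalg[OF subP]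
    by (intro emeasure_density) auto
  also have "\<dots> = (\<integral>\<^sup>+\<omega>. ?Z \<omega> * indicator A \<omega> \<partial>P)"
    by (intro nn_integral_subalgebra2[OF subP] borel_measurable_times_ennreal
        borel_measurable_indicator Z A)
  also have "\<dots> = (\<integral>\<^sup>+\<omega>. exp_density W c t \<omega> * indicator A \<omega> \<partial>P)"
  proof (rule nn_integral_cong_AE)
    have "AE \<omega> in P. \<forall>u\<in>{0..T}. J u \<omega> = c * W u \<omega>"
      by (rule ito_integral_const_unique[OF bm T mono J]) auto
    then show "AE \<omega> in P. ?Z \<omega> * indicator A \<omega> = exp_density W c t \<omega> * indicator A \<omega>"
      by eventually_elim (use t in \<open>simp add: exp_density_def set_lebesgue_integral_def mult.commute\<close>)
  qed
  finally show ?thesis .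
qed

text \<open>The density at the final time \<open>T\<close> defines the measure on the whole sigma-algebra of \<open>P\<close>; the martingale property
  pulls it back to the density at time \<open>t\<close> on the events known at \<open>t\<close>.\<close>

lemma girsanov_measure_exists:
  assumes bm: "brownian_motion P F T W" and T: "0 \<le> T"
    and mono: "\<And>s t. 0 \<le> s \<Longrightarrow> s \<le> t \<Longrightarrow> t \<le> T \<Longrightarrow> sets (F s) \<subseteq> sets (F t)"
  shows "girsanov_measure P F W T (\<lambda>_ _. c) (density P (exp_density W c T))"
proof -
  note b = brownian_motionD[OF bm]
  let ?Q = "density P (exp_density W c T)"
  have TT: "T \<in> {0..T}" using T by simp
  have Z [measurable]: "exp_density W c T \<in> borel_measurable P"
    using adaptedD(2)[OF b(3) b(2) TT] by (rule exp_density_measurable)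
  have "absolutely_continuous ?Q P"
    unfolding absolutely_continuous_def
  proof
    fix N assume N: "N \<in> null_sets ?Q"
    then have "AE \<omega> in P. \<omega> \<in> N \<longrightarrow> exp_density W c T \<omega> = 0" "N \<in> sets P"
      unfolding null_sets_density_iff[OF Z] by auto
    then have "AE \<omega> in P. \<omega> \<notin> N" by (auto simp: exp_density_def)
    then show "N \<in> null_sets P" using AE_iff_null_sets[OF \<open>N \<in> sets P\<close>] by simp
  qed
  then have eq: "equivalent_measure P ?Q"
    using absolutely_continuousI_density[OF Z] by (simp add: equivalent_measure_def)
  have "restr_to_subalg ?Q (F t) = density (restr_to_subalg P (F t))
      (\<lambda>\<omega>. ennreal (exp (c * W t \<omega> - 1 / 2 * (LBINT s:{0..t}. c\<^sup>2))))" if t: "t \<in> {0..T}" for t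
  proof -
    have subP: "subalgebra P (F t)" by (rule b(2)[OF t])
    then have subQ: "subalgebra ?Q (F t)" by (simp add: subalgebra_def)
    have Zt [measurable]: "exp_density W c t \<in> borel_measurable (F t)"
      using adaptedD(1)[OF b(3) b(2) t] by (rule exp_density_measurable)
    have "restr_to_subalg ?Q (F t) = density (restr_to_subalg P (F t)) (exp_density W c t)"
    proof (rule measure_eqI)
      show "sets (restr_to_subalg ?Q (F t)) =
          sets (density (restr_to_subalg P (F t)) (exp_density W c t))"
        using sets_restr_to_subalg[OF subP] sets_restr_to_subalg[OF subQ] by simp
      fix A assume "A \<in> sets (restr_to_subalg ?Q (F t))"
      then have A: "A \<in> sets (F t)" using sets_restr_to_subalg[OF subQ] by simp
      then have AP: "A \<in> sets P" using subP by (auto simp: subalgebra_def)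
      have "emeasure (restr_to_subalg ?Q (F t)) A = emeasure ?Q A"
        by (rule emeasure_restr_to_subalg[OF subQ A])
      also have "\<dots> = (\<integral>\<^sup>+\<omega>. exp_density W c T \<omega> * indicator A \<omega> \<partial>P)"
        using AP by (intro emeasure_density) auto
      also have "\<dots> = (\<integral>\<^sup>+\<omega>. exp_density W c t \<omega> * indicator A \<omega> \<partial>P)"
        using t A by (intro exp_density_martingale[OF bm]) auto
      also have "\<dots> = (\<integral>\<^sup>+\<omega>. exp_density W c t \<omega> * indicator A \<omega> \<partial>restr_to_subalg P (F t))"
        by (intro nn_integral_subalgebra2[OF subP, symmetric] borel_measurable_times_ennreal
            borel_measurable_indicator Zt A)
      also have "\<dots> = emeasure (density (restr_to_subalg P (F t)) (exp_density W c t)) A"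
        using A measurable_in_subalg[OF subP Zt] sets_restr_to_subalg[OF subP]
        by (intro emeasure_density[symmetric]) auto
      finally show "emeasure (restr_to_subalg ?Q (F t)) A =
          emeasure (density (restr_to_subalg P (F t)) (exp_density W c t)) A" .
    qed
    also have "exp_density W c t =
        (\<lambda>\<omega>. ennreal (exp (c * W t \<omega> - 1 / 2 * (LBINT s:{0..t}. c\<^sup>2))))"
      using t by (auto simp: exp_density_def set_lebesgue_integral_def mult.commute)
    finally show ?thesis .
  qed
  then show ?thesis
    using eq ito_integral_const[OF bm T] unfolding girsanov_measure_def by blast
qed

section \<open>Scaled Brownian motion as a local martingale\<close>

text \<open>Written with \<open>min t T\<close> and the initial value subtracted since this is the form in which a local
  martingale on \<open>[0,T]\<close> stopped at the constant time \<open>T\<close> appears.\<close>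

lemma martingale_brownian_increment:
  assumes bm: "brownian_motion P F T W" and T: "0 \<le> T"
    and mono: "\<And>s t. 0 \<le> s \<Longrightarrow> s \<le> t \<Longrightarrow> t \<le> T \<Longrightarrow> sets (F s) \<subseteq> sets (F t)"
  shows "martingale P F T (\<lambda>t \<omega>. k * W (min t T) \<omega> - k * W 0 \<omega>)"
proof -
  note b = brownian_motionD[OF bm]
  interpret prob_space P by (rule b)
  let ?X = "\<lambda>t \<omega>. k * W (min t T) \<omega> - k * W 0 \<omega>"
  have ad: "adapted F 0 T ?X"
    unfolding adapted_def
  proof
    fix t assume t: "t \<in> {0..T}"
    then have z: "0 \<in> {0..T}" by simp
    have le: "(0::real) \<le> 0" "0 \<le> t" "t \<le> T" using t by auto
    have [measurable]: "W t \<in> borel_measurable (F t)" "W 0 \<in> borel_measurable (F t)"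
      using adaptedD(1)[OF b(3) b(2) t]
        measurable_mono_filtration[OF b(2)[OF z] b(2)[OF t] mono[OF le] adaptedD(1)[OF b(3) b(2) z]]
      by auto
    have "?X t = (\<lambda>\<omega>. k * W t \<omega> - k * W 0 \<omega>)" using t by (simp add: min_def)
    then show "?X t \<in> borel_measurable (F t)" by simp
  qed
  have int: "integrable P (?X t)" if t: "t \<in> {0..T}" for t
  proof (cases "t = 0")
    case False
    have "integrable P (\<lambda>\<omega>. k * (W t \<omega> - W 0 \<omega>))"
      using increment_moments(1)[OF bm, of 0 t] t False by auto
    then show ?thesis using t by (simp add: min_def algebra_simps)
  qed (use T in simp)
  have "AE \<omega> in P. real_cond_exp P (F s) (?X t) \<omega> = ?X s \<omega>"
    if st: "0 \<le> s" "s \<le> t" "t \<le> T" for s t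
  proof -
    have sT: "s \<in> {0..T}" "t \<in> {0..T}" using st by auto
    interpret finite_measure_subalgebra P "F s"
      by unfold_locales (rule b(2)[OF sT(1)])
    show ?thesis
    proof (rule real_cond_exp_charact)
      show "integrable P (?X t)" "integrable P (?X s)" using int sT by auto
      show "?X s \<in> borel_measurable (F s)" using ad sT unfolding adapted_def by blast
      fix A assume A: "A \<in> sets (F s)"
      then have AP: "A \<in> sets P" using b(2)[OF sT(1)] by (auto simp: subalgebra_def)
      show "(LINT \<omega>:A|P. ?X t \<omega>) = (LINT \<omega>:A|P. ?X s \<omega>)"
      proof (cases "s = t")
        case False
        then have lt: "s < t" using st by simp
        have X: "(indicator A :: 'a \<Rightarrow> real) \<in> borel_measurable (F s)" "integrable P (indicator A :: 'a \<Rightarrow> real)"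
          using A AP by (auto intro!: integrable_real_indicator simp: less_top[symmetric])
        have meas: "(\<lambda>x::real. x) \<in> borel_measurable borel" by simp
        note i = increment_indep_integral[OF bm st(1) lt st(3) X meas
            increment_moments(1)[OF bm st(1) lt st(3)]]
        have dec: "indicator A \<omega> *\<^sub>R ?X t \<omega> =
            indicator A \<omega> *\<^sub>R ?X s \<omega> + k * (indicator A \<omega> * (W t \<omega> - W s \<omega>))" for \<omega>
          using st by (simp add: min_def algebra_simps)
        have "integrable P (\<lambda>\<omega>. indicator A \<omega> *\<^sub>R ?X s \<omega>)"
          using int[OF sT(1)] AP by (intro integrable_mult_indicator) auto
        then show ?thesis
          unfolding set_lebesgue_integral_def dec
          using i increment_moments(2)[OF bm st(1) lt st(3)]
          by (subst Bochner_Integration.integral_add) auto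
      qed simp
    qed
  qed
  then show ?thesis using ad int unfolding martingale_def by blast
qed

lemma continuous_imp_cadlag_on:
  assumes "continuous_on {0..T} x"
  shows "cadlag_on T x"
  unfolding cadlag_on_def
proof (intro conjI ballI)
  have lim: "(x \<longlongrightarrow> x t) (at t within {0..T})" if "t \<in> {0..T}" for t
    using assms that by (simp add: continuous_on)
  show "(x \<longlongrightarrow> x t) (at_right t)" if t: "t \<in> {0..<T}" for t
  proof -
    have "(x \<longlongrightarrow> x t) (at t within {t..T})"
      using t by (intro tendsto_within_subset[OF lim]) auto
    then show ?thesis using t by (simp add: at_within_Icc_at_right)
  qed
  show "\<exists>l. (x \<longlongrightarrow> l) (at_left t)" if t: "t \<in> {0<..T}" for t
  proof -
    have "(x \<longlongrightarrow> x t) (at t within {0..t})"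
      using t by (intro tendsto_within_subset[OF lim]) auto
    then show ?thesis using t by (auto simp: at_within_Icc_at_left)
  qed
qed

lemma local_martingale_brownian:
  assumes bm: "brownian_motion P F T W" and T: "0 \<le> T"
    and mono: "\<And>s t. 0 \<le> s \<Longrightarrow> s \<le> t \<Longrightarrow> t \<le> T \<Longrightarrow> sets (F s) \<subseteq> sets (F t)"
  shows "local_martingale P F T (\<lambda>t \<omega>. k * W t \<omega>)"
proof -
  note b = brownian_motionD[OF bm]
  have "adapted F 0 T (\<lambda>t \<omega>. k * W t \<omega>)" using b(3) unfolding adapted_def by auto
  moreover have "AE \<omega> in P. cadlag_on T (\<lambda>t. k * W t \<omega>)"
    using b(4) unfolding continuous_paths_def
    by eventually_elim (intro continuous_imp_cadlag_on continuous_intros)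
  ultimately show ?thesis
    using martingale_brownian_increment[OF bm T mono] T unfolding local_martingale_def
    by (intro conjI exI[of _ "\<lambda>_ _. T"]) auto
qed

lemma finite_variation_linear:
  assumes "0 \<le> T"
  shows "finite_variation_on T (\<lambda>t. a * t)"
  unfolding finite_variation_on_def
proof (intro exI allI impI)
  fix n :: nat and \<tau> :: "nat \<Rightarrow> real"
  assume \<tau>: "(\<forall>i\<le>n. \<tau> i \<in> {0..T}) \<and> (\<forall>i<n. \<tau> i \<le> \<tau> (Suc i))"
  have "(\<Sum>i<n. \<bar>a * \<tau> (Suc i) - a * \<tau> i\<bar>) = (\<Sum>i<n. \<bar>a\<bar> * (\<tau> (Suc i) - \<tau> i))"
    using \<tau> by (intro sum.cong) (auto simp: right_diff_distrib[symmetric] abs_mult)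
  also have "\<dots> = \<bar>a\<bar> * (\<tau> n - \<tau> 0)"
    by (simp add: sum_distrib_left[symmetric] sum_lessThan_telescope)
  finally have sum: "(\<Sum>i<n. \<bar>a * \<tau> (Suc i) - a * \<tau> i\<bar>) = \<bar>a\<bar> * (\<tau> n - \<tau> 0)" .
  have "\<tau> n \<in> {0..T}" "\<tau> 0 \<in> {0..T}" using \<tau> by auto
  then have "\<bar>a\<bar> * (\<tau> n - \<tau> 0) \<le> \<bar>a\<bar> * T" by (intro mult_left_mono) auto
  then show "(\<Sum>i<n. \<bar>a * \<tau> (Suc i) - a * \<tau> i\<bar>) \<le> \<bar>a\<bar> * T" unfolding sum .
qed

section \<open>The canonical Neural-Brownian Motion under the new measure\<close>

lemma positive_root_quadratic:
  assumes "\<alpha> \<noteq> 0" "0 < \<beta> / \<alpha>" "\<And>z. g t x z = \<alpha> / 2 * z\<^sup>2 - \<beta>"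
  shows "positive_root g t x = sqrt (2 * \<beta> / \<alpha>)"
  unfolding positive_root_def
proof (rule the_equality)
  have pos: "0 < 2 * \<beta> / \<alpha>" using assms(2) by simp
  show "0 < sqrt (2 * \<beta> / \<alpha>) \<and> g t x (sqrt (2 * \<beta> / \<alpha>)) = 0"
    using pos assms(1) by (simp add: assms(3))
  fix z assume z: "0 < z \<and> g t x z = 0"
  then have "z\<^sup>2 = 2 * \<beta> / \<alpha>" using assms(1) by (simp add: assms(3) field_simps)
  then show "z = sqrt (2 * \<beta> / \<alpha>)" using z by (metis less_imp_le real_sqrt_unique)
qed

lemma semimartingale_scaled_brownian:
  assumes bm: "brownian_motion Q F T B" and T: "0 \<le> T"
    and mono: "\<And>s t. 0 \<le> s \<Longrightarrow> s \<le> t \<Longrightarrow> t \<le> T \<Longrightarrow> sets (F s) \<subseteq> sets (F t)"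
    and ad: "adapted F 0 T X" and cont: "continuous_paths Q 0 T X"
    and X: "AE \<omega> in Q. \<forall>t\<in>{0..T}. X t \<omega> = X 0 \<omega> + k * B t \<omega> + a * t"
  shows "semimartingale Q F T X"
proof -
  have "AE \<omega> in Q. cadlag_on T (\<lambda>t. X t \<omega>)"
    using cont unfolding continuous_paths_def by eventually_elim (rule continuous_imp_cadlag_on)
  moreover have "adapted F 0 T (\<lambda>t \<omega>. a * t)" by (simp add: adapted_def)
  moreover have "cadlag_on T (\<lambda>t. a * t)"
    by (intro continuous_imp_cadlag_on continuous_intros)
  then have "AE \<omega> in Q. cadlag_on T (\<lambda>t. a * t) \<and> finite_variation_on T (\<lambda>t. a * t)"
    using finite_variation_linear[OF T, of a] by (intro AE_I2 conjI)
  ultimately show ?thesis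
    unfolding semimartingale_def
    using ad X local_martingale_brownian[OF bm T mono, of k]
    by (intro conjI exI[of _ "\<lambda>t \<omega>. k * B t \<omega>"] exI[of _ "\<lambda>t \<omega>. a * t"])
qed

lemma ito_differential_scaled_brownian:
  assumes bm: "brownian_motion Q F T B" and T: "0 \<le> T"
    and ad: "adapted F 0 T X" and cont: "continuous_paths Q 0 T X"
    and X: "AE \<omega> in Q. \<forall>t\<in>{0..T}. X t \<omega> = X 0 \<omega> + k * B t \<omega> + a * t"
  shows "has_ito_differential Q F B 0 T X (\<lambda>t \<omega>. a) (\<lambda>t \<omega>. k)"
proof -
  have int: "set_integrable lborel {0..T} (\<lambda>u. a)"
    unfolding set_integrable_def using T by (simp add: integrable_real_mult_indicator)
  have "AE \<omega> in Q. \<forall>u\<in>{0..T}. X u \<omega> = X 0 \<omega> + (LBINT r:{0..u}. a) + k * B u \<omega>"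
    using X
  proof eventually_elim
    case (elim \<omega>)
    show ?case
    proof
      fix u assume u: "u \<in> {0..T}"
      show "X u \<omega> = X 0 \<omega> + (LBINT r:{0..u}. a) + k * B u \<omega>"
        using bspec[OF elim u] u by (simp add: set_lebesgue_integral_def mult.commute)
    qed
  qed
  then show ?thesis
    unfolding has_ito_differential_def using ad cont AE_I2[OF int] ito_integral_const[OF bm T, of k]
    by (intro conjI exI[of _ "\<lambda>u \<omega>. k * B u \<omega>"])
qed

theorem theorem5p2:
  fixes P :: "'a measure" and T :: real and W :: "'a process"
    and F :: "real \<Rightarrow> 'a measure"
    and S :: "real \<Rightarrow> real \<Rightarrow> ('a process \<times> 'a process) set"
    and f :: driver and \<alpha> \<beta> \<nu> :: real and M \<gamma> :: "'a process"
  assumes "prob_space P" and "complete_measure P" and "0 < T"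
    and "brownian_motion P (natural_filtration P W) T W"
    and "F = augmented_filtration P W"
    and "\<alpha> \<noteq> 0" and "\<beta> / \<alpha> > 0"
    and "\<forall>t\<in>{0..T}. \<forall>m z. specialization f t m z = \<alpha> / 2 * z\<^sup>2 - \<beta>"
    and "\<nu> = sqrt (2 * \<beta> / \<alpha>)"
    and "corresponding_canonical_NBM P W T S f M"
    and "\<gamma> = (\<lambda>t \<omega>. \<alpha> * \<nu>)"
  shows "(\<exists>Q. girsanov_measure P F W T \<gamma> Q) \<and>
    (\<forall>Q. girsanov_measure P F W T \<gamma> Q \<longrightarrow>
       semimartingale Q F T M \<and>
       (\<exists>W\<^sub>\<alpha>. brownian_motion Q F T W\<^sub>\<alpha> \<and>
          has_ito_differential Q F W\<^sub>\<alpha> 0 T M (\<lambda>t \<omega>. \<alpha> * \<nu>\<^sup>2) (\<lambda>t \<omega>. \<nu>)))"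
proof -
  have T: "0 \<le> T" using assms(3) by simp
  have bm: "brownian_motion P F T W"
    unfolding assms(5) by (rule brownian_motion_augmented[OF assms(4)])
  have mono: "sets (F s) \<subseteq> sets (F t)" if "0 \<le> s" "s \<le> t" "t \<le> T" for s t
    unfolding assms(5) by (rule augmented_filtration_mono[OF that(2)])
  have root: "positive_root (specialization f) u x = \<nu>" if "u \<in> {0..T}" for u x
    unfolding assms(9) using assms(6,7,8) that by (intro positive_root_quadratic) auto
  have dM: "has_ito_differential P F W 0 T M (\<lambda>u \<omega>. 0)
      (\<lambda>u \<omega>. positive_root (specialization f) u (M u \<omega>))"
    using assms(10) unfolding corresponding_canonical_NBM_def sde_strong_solution_def assms(5) by auto
  have ad: "adapted F 0 T M" and contP: "continuous_paths P 0 T M"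
    using dM unfolding has_ito_differential_def by auto
  obtain I where I: "ito_integral P F W 0 T (\<lambda>u \<omega>. positive_root (specialization f) u (M u \<omega>)) I"
    and MI: "AE \<omega> in P. \<forall>u\<in>{0..T}. M u \<omega> = M 0 \<omega> + (LBINT r:{0..u}. 0) + I u \<omega>"
    using dM unfolding has_ito_differential_def by blast
  have "AE \<omega> in P. \<forall>u\<in>{0..T}. I u \<omega> = \<nu> * W u \<omega>"
    by (rule ito_integral_const_unique[OF bm T mono I root]) auto
  with MI have MW: "AE \<omega> in P. \<forall>u\<in>{0..T}. M u \<omega> = M 0 \<omega> + \<nu> * W u \<omega>"
  proof eventually_elim
    case (elim \<omega>)
    show ?case
    proof
      fix u assume u: "u \<in> {0..T}"
      show "M u \<omega> = M 0 \<omega> + \<nu> * W u \<omega>"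
        using bspec[OF elim(1) u] unfolding bspec[OF elim(2) u]
        by (simp add: set_lebesgue_integral_def)
    qed
  qed
  have "semimartingale Q F T M \<and>
      (\<exists>W\<^sub>\<alpha>. brownian_motion Q F T W\<^sub>\<alpha> \<and>
        has_ito_differential Q F W\<^sub>\<alpha> 0 T M (\<lambda>t \<omega>. \<alpha> * \<nu>\<^sup>2) (\<lambda>t \<omega>. \<nu>))"
    if Q: "girsanov_measure P F W T (\<lambda>t \<omega>. \<alpha> * \<nu>) Q" for Q
  proof -
    have sets: "sets Q = sets P" and ac: "absolutely_continuous P Q"
      using Q by (auto simp: girsanov_measure_def equivalent_measure_def)
    have bmQ: "brownian_motion Q F T (\<lambda>t \<omega>. W t \<omega> - \<alpha> * \<nu> * t)"
      by (rule brownian_motion_girsanov[OF bm T sets ac girsanov_measure_emeasure[OF bm T mono Q] mono])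
    have cont: "continuous_paths Q 0 T M"
      by (rule continuous_paths_transfer[OF sets ac contP])
    have X: "AE \<omega> in Q. \<forall>t\<in>{0..T}.
        M t \<omega> = M 0 \<omega> + \<nu> * (W t \<omega> - \<alpha> * \<nu> * t) + \<alpha> * \<nu>\<^sup>2 * t"
      using absolutely_continuous_AE[OF sets ac MW]
    proof eventually_elim
      case (elim \<omega>)
      show ?case
      proof
        fix t assume "t \<in> {0..T}"
        from bspec[OF elim this]
        show "M t \<omega> = M 0 \<omega> + \<nu> * (W t \<omega> - \<alpha> * \<nu> * t) + \<alpha> * \<nu>\<^sup>2 * t"
          by (simp add: power2_eq_square algebra_simps)
      qed
    qed
    show ?thesis
      using semimartingale_scaled_brownian[OF bmQ T mono ad cont X]
        ito_differential_scaled_brownian[OF bmQ T ad cont X] bmQ by blast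
  qed
  then show ?thesis
    using girsanov_measure_exists[OF bm T mono, of "\<alpha> * \<nu>"] unfolding assms(11) by blast
qed

end
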